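(* Let $H(k)$, $k\in\mathbb{R}\ (\mathrm{mod}\ 2\pi)$, be the $n\times n$ Hermitian Bloch Hamiltonian of a one-dimensional tight-binding system with $n$ orbitals per unit cell and maximal hopping range $m$, i.e. every matrix element of $H(k)$ is of the form $\sum_{l=-m}^{m}a_l e^{ilk}$. Assume the system has one isolated flat band with a finite band gap, the energy origin being chosen so that the flat-band energy is $0$: for every real $k$, $0$ is a simple eigenvalue of $H(k)$, and the remaining eigenvalues are separated from $0$ by a gap. Put $N=(n-1)m$, let $P_f(k)$ be the orthogonal projection onto the flat-band eigenvector of $H(k)$, and define the quantum metric and the quantum metric length by $$\mathcal{G}(k)=\tfrac12\,\mathrm{Tr}\big[(\partial_k P_f(k))^2\big],\qquad \ell_{QM}=\int_0^{2\pi}\frac{dk}{2\pi}\,\mathcal{G}(k).$$ Let $x_\ell+iy_\ell$, $y_\ell>0$, $\ell=1,\dots,N$, be the poles of $P_f$ in the upper half plane (the zeros there of the degree-$N$ denominator of $P_f$, as specified in the context), and let $y_{\min}$ be the imaginary part of the pole closest to the real axis. Then $$\ell_{QM}\;\le\;\frac14\sum_{i=1}^{N}\sum_{j=1}^{N}P_{y_i+y_j}(x_i-x_j)\;\le\;\frac{N^2}{4}\coth y_{\min},$$ where $P_y(x)=\dfrac{\sinh y}{\cosh y-\cos x}$ is the Poisson kernel.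
   Context: The lattice constant is $1$, so $k$ is taken modulo $2\pi$. A trigonometric polynomial of degree $N$ is an expression $\sum_{l=-N}^{N}c_l e^{ilk}$ with $c_l\in\mathbb{C}$. The flat-band projection is $$P_f(k)=\frac{\mathrm{adj}(H(k))}{\mathrm{tr}(\mathrm{adj}(H(k)))},$$ where $\mathrm{adj}$ is the adjugate matrix. The entries of $P_f$ are thus rational trigonometric functions whose numerator and denominator are trigonometric polynomials of order $N=(n-1)m$. The common denominator $\mathrm{tr}(\mathrm{adj}(H(k)))$ equals the product of the non-flat-band eigenvalues of $H(k)$; it is real for real $k$, so its $2N$ complex zeros (modulo $2\pi$, with multiplicity) occur symmetrically about the real axis and can be written as $x_\ell+iy_\ell$ and $x_\ell-iy_\ell$ with $y_\ell>0$, $\ell=1,\dots,N$. These $x_\ell+iy_\ell$ are what is meant by the poles of $P_f$ in the upper half plane. *)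

theory Defs
  imports "HOL-Complex_Analysis.Complex_Analysis"
begin

definition conj_transpose :: "complex^'n^'m \<Rightarrow> complex^'m^'n" where
  "conj_transpose A = (\<chi> i j. cnj (A $ j $ i))"

definition hermitian :: "complex^'n^'n \<Rightarrow> bool" where
  "hermitian A \<longleftrightarrow> conj_transpose A = A"

(* The (j,i) cofactor is the determinant of A with its j-th row replaced by the
   i-th unit row vector; the adjugate is the transposed cofactor matrix. *)
definition adjugate :: "'a::comm_ring_1^'n^'n \<Rightarrow> 'a^'n^'n" where
  "adjugate A = (\<chi> i j. det (\<chi> p q. if p = j then (if q = i then 1 else 0) else A $ p $ q))"

definition charpoly :: "'a::comm_ring_1^'n^'n \<Rightarrow> 'a poly" where
  "charpoly A = det (\<chi> i j. (if i = j then [:0, 1:] else 0) - [:A $ i $ j:])"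

definition eigenvalue :: "'a::field^'n^'n \<Rightarrow> 'a \<Rightarrow> bool" where
  "eigenvalue A c \<longleftrightarrow> (\<exists>v. v \<noteq> 0 \<and> A *v v = c *s v)"

definition simple_eigenvalue :: "'a::field^'n^'n \<Rightarrow> 'a \<Rightarrow> bool" where
  "simple_eigenvalue A c \<longleftrightarrow> eigenvalue A c \<and> order c (charpoly A) = 1"

definition eigenspace :: "'a::field^'n^'n \<Rightarrow> 'a \<Rightarrow> ('a^'n) set" where
  "eigenspace A c = {v. A *v v = c *s v}"

(* Orthogonality is with respect to the sesquilinear inner product: a matrix is an
   orthogonal projection iff it is idempotent and Hermitian. *)
definition orthogonal_projection_onto :: "complex^'n^'n \<Rightarrow> (complex^'n) set \<Rightarrow> bool" where
  "orthogonal_projection_onto P S \<longleftrightarrow> hermitian P \<and> P ** P = P \<and> range ((*v) P) = S"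

(* The Bloch Hamiltonian with hopping matrices a l, as a function of complex
   quasi-momentum, so that the zeros of its adjugate trace off the real axis make sense. *)
definition bloch_hamiltonian :: "(int \<Rightarrow> complex^'n^'n) \<Rightarrow> nat \<Rightarrow> complex \<Rightarrow> complex^'n^'n" where
  "bloch_hamiltonian a m k =
     (\<chi> p q. \<Sum>l = - int m..int m. a l $ p $ q * exp (\<i> * of_int l * k))"

definition isolated_flat_band_at_zero :: "(complex \<Rightarrow> complex^'n^'n) \<Rightarrow> bool" where
  "isolated_flat_band_at_zero H \<longleftrightarrow>
     (\<forall>k::real. simple_eigenvalue (H (of_real k)) 0) \<and>
     (\<exists>\<Delta>>0. \<forall>k::real. \<forall>c. eigenvalue (H (of_real k)) c \<longrightarrow> c \<noteq> 0 \<longrightarrow> \<Delta> \<le> cmod c)"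

definition flat_band_denominator :: "(complex \<Rightarrow> complex^'n^'n) \<Rightarrow> complex \<Rightarrow> complex" where
  "flat_band_denominator H k = trace (adjugate (H k))"

(* The points x l + i y l (l = 1..N) list the zeros of D in the upper half plane modulo
   2 pi, each as often as its multiplicity.  For an entire D that does not vanish
   identically, zorder D z is the multiplicity of z as a zero (0 if D z is nonzero). *)
definition lists_upper_zeros ::
    "(complex \<Rightarrow> complex) \<Rightarrow> nat \<Rightarrow> (nat \<Rightarrow> real) \<Rightarrow> (nat \<Rightarrow> real) \<Rightarrow> bool" where
  "lists_upper_zeros D N x y \<longleftrightarrow>
     (\<forall>l\<in>{1..N}. y l > 0) \<and>
     (\<forall>z. Im z > 0 \<longrightarrow>
        int (card {l\<in>{1..N}. \<exists>q::int. z = Complex (x l) (y l) + of_real (2 * pi * of_int q)})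
          = zorder D z)"

(* The trace is real whenever P is Hermitian-valued. *)
definition quantum_metric :: "(real \<Rightarrow> complex^'n^'n) \<Rightarrow> real \<Rightarrow> real" where
  "quantum_metric P k =
     1/2 * Re (trace (vector_derivative P (at k) ** vector_derivative P (at k)))"

definition quantum_metric_length :: "(real \<Rightarrow> complex^'n^'n) \<Rightarrow> real" where
  "quantum_metric_length P = integral {0..2*pi} (\<lambda>k. quantum_metric P k / (2*pi))"

definition poisson_kernel :: "real \<Rightarrow> real \<Rightarrow> real" where
  "poisson_kernel y x = sinh y / (cosh y - cos x)"

definition coth :: "real \<Rightarrow> real" where
  "coth y = cosh y / sinh y"

end

theory Submission
  imports Defs
begin

text \<open>
  Put z = exp (i k). After multiplication by z^N, the adjugate of H and its trace become polynomials
  of degree at most 2N in z, and their quotient is the projection P. Because the trace is real for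
  real k, its polynomial is a multiple of q q*, where q has the N roots z_l = exp (i (x_l + i y_l))
  in the unit disc and q* the reflected roots. So every form f(k) = <w, P(k) w> - 1 with |w|^2 = 2 is
  real with values in [-1, 1] and becomes holomorphic in the disc when multiplied by the Blaschke
  product B = q/q*. A Bernstein inequality then gives |f'| <= Theta at the zeros of f, where
  Theta(k) = sum over l of P_{y_l}(k - x_l) is the derivative of the phase of B. For a suitable w
  this says that the quantum metric at k is at most Theta(k)^2 / 4, and integrating Theta^2 with
  Poisson's formula yields the double sum.
\<close>

(* With both meanings of $ active, long matrix expressions have exponentially many parse trees. *)
no_notation fps_nth (infixl "$" 75)

section \<open>A Bernstein inequality on the unit circle\<close>

text \<open>Bernstein's inequality is scalar while the metric is a matrix quantity. The bridge is
  that P' has rank at most two: with v spanning the flat band and u = P' v, it acts on span(v, u) as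
  |u| times the exchange of v and u/|u|, and the metric equals |u|^2. A single eigenvector w of P'
  therefore sees the whole metric, as the slope 2 |u| of its form; squaring 2 |u| \<le> \<Theta>
  produces the constant 1/4. The same w makes f vanish at k, which is why the inequality is only
  needed at zeros, where it has a short proof by a phase argument.

  The other obstacle is bookkeeping of zeros. They are listed as points k modulo 2 pi with
  multiplicity, whereas the Blaschke product needs a factorization of a polynomial in z. A
  polynomial of degree at most 2N with N zeros in the disc has room for N further ones, and these
  are forced by reflection in the circle. This pins the denominator down up to a constant, so that
  \<Theta> contains exactly the listed poles.

  The final estimate discards the positions x_l: it uses only the maximum of each Poisson kernel and
  its monotonicity in y.\<close>

lemma cis_Arg_unit: "norm z = 1 \<Longrightarrow> cis (Arg z) = z"
  by (metis cis_Arg div_by_1 norm_zero of_real_1 sgn_div_norm sgn_eq zero_neq_one)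

text \<open>By the maximum principle \<open>Re (cnj (g \<zeta>) * g (r \<zeta>))\<close> is at most
  1 for r in [0, 1] and reaches 1 at r = 1, so its derivative there is not negative. As
  \<open>1 / g \<zeta> = cnj (g \<zeta>)\<close>, that derivative is the real part in question. For
  g unimodular on the circle it is the speed of the phase of g.\<close>

lemma Re_log_deriv_ge_0_boundary:
  fixes g :: "complex \<Rightarrow> complex"
  assumes S: "open S" "cball 0 1 \<subseteq> S" and g: "g holomorphic_on S"
    and le: "\<And>z. norm z = 1 \<Longrightarrow> norm (g z) \<le> 1"
    and \<zeta>: "norm \<zeta> = 1" "norm (g \<zeta>) = 1"
  shows "0 \<le> Re (\<zeta> * deriv g \<zeta> / g \<zeta>)"
proof -
  define \<psi> where "\<psi> = (\<lambda>r::real. Re (cnj (g \<zeta>) * g (of_real r * \<zeta>)))"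
  have mem: "\<zeta> \<in> S" using S \<zeta> by auto
  have "norm (g z) \<le> 1" if "z \<in> cball 0 1" for z
  proof (rule maximum_modulus_frontier[of g "cball 0 1"])
    show "g holomorphic_on interior (cball 0 1)"
      using g S by (meson holomorphic_on_subset interior_subset order_trans)
    show "continuous_on (closure (cball 0 1)) g"
      using g S by (auto intro: continuous_on_subset holomorphic_on_imp_continuous_on)
  qed (use le that in \<open>auto simp: dist_norm\<close>)
  then have le1: "\<psi> r \<le> 1" if "0 \<le> r" "r \<le> 1" for r
  proof -
    have "\<psi> r \<le> norm (cnj (g \<zeta>) * g (of_real r * \<zeta>))"
      unfolding \<psi>_def by (rule complex_Re_le_cmod)
    also have "\<dots> \<le> 1"
      using \<zeta> that \<open>\<And>z. z \<in> cball 0 1 \<Longrightarrow> norm (g z) \<le> 1\<close>[of "of_real r * \<zeta>"]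
      by (simp add: norm_mult)
    finally show ?thesis .
  qed
  have cc: "cnj (g \<zeta>) * g \<zeta> = 1"
    using \<zeta>(2) by (metis complex_norm_square mult.commute of_real_1 power_one)
  have \<psi>1: "\<psi> 1 = 1" by (simp only: \<psi>_def of_real_1 mult_1 cc) simp
  have "(g has_field_derivative deriv g \<zeta>) (at (of_real 1 * \<zeta>))"
    using holomorphic_derivI[OF g S(1) mem] by simp
  then have "((\<lambda>z. cnj (g \<zeta>) * g (z * \<zeta>)) has_field_derivative cnj (g \<zeta>) * (deriv g \<zeta> * \<zeta>)) (at (of_real 1))"
    by (auto intro!: derivative_eq_intros DERIV_chain2[where f = g])
  then have "(\<psi> has_real_derivative Re (cnj (g \<zeta>) * (deriv g \<zeta> * \<zeta>))) (at 1)"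
    unfolding \<psi>_def by (intro has_field_derivative_Re has_vector_derivative_real_field)
  then have d: "DERIV \<psi> 1 :> Re (cnj (g \<zeta>) * (deriv g \<zeta> * \<zeta>))" .
  have "0 \<le> Re (cnj (g \<zeta>) * (deriv g \<zeta> * \<zeta>))"
  proof (rule ccontr)
    assume "\<not> ?thesis"
    then obtain e where e: "e > 0" "\<And>h. h > 0 \<Longrightarrow> h < e \<Longrightarrow> \<psi> 1 < \<psi> (1 - h)"
      using DERIV_neg_dec_left[OF d] by auto
    show False using e(2)[of "min (e/2) 1"] e(1) le1[of "1 - min (e/2) 1"] \<psi>1 by (cases "e \<le> 2") (auto simp: min_def)
  qed
  moreover have "g \<zeta> \<noteq> 0" using \<zeta> by auto
  then have "1 / g \<zeta> = cnj (g \<zeta>)" using cc by (simp add: field_simps)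
  then have "\<zeta> * deriv g \<zeta> / g \<zeta> = cnj (g \<zeta>) * (deriv g \<zeta> * \<zeta>)"
    by (metis mult.commute times_divide_eq_right mult.right_neutral)
  ultimately show ?thesis by simp
qed

text \<open>For \<open>B z = z ^ N\<close> this is the classical bound |F'| \<le> N at a zero of a
  real trigonometric polynomial of degree at most N that is bounded by 1. In general N is replaced
  by the speed of the phase of \<open>B\<close>.\<close>

lemma bernstein_unimodular:
  fixes h B :: "complex \<Rightarrow> complex" and F :: "real \<Rightarrow> real"
  assumes S: "open S" "cball 0 1 \<subseteq> S" and h: "h holomorphic_on S" and B: "B holomorphic_on S"
    and B1: "\<And>z. norm z = 1 \<Longrightarrow> norm (B z) = 1"
    and hF: "\<And>t. h (cis t) = B (cis t) * of_real (F t)"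
    and F1: "\<And>t. \<bar>F t\<bar> \<le> 1" and F0: "F t0 = 0"
    and F': "(F has_real_derivative s) (at t0)"
  shows "\<bar>s\<bar> \<le> Re (cis t0 * deriv B (cis t0) / B (cis t0))"
proof -
  define \<zeta> where "\<zeta> = cis t0"
  define b where "b = B \<zeta>"
  have [simp]: "norm \<zeta> = 1" "norm b = 1" by (auto simp: \<zeta>_def b_def B1)
  have mem: "\<zeta> \<in> S" using S by auto
  have h0: "h \<zeta> = 0" by (simp add: \<zeta>_def hF F0)
  have cb: "cnj b * b = 1"
    using \<open>norm b = 1\<close> by (metis complex_norm_square mult.commute of_real_1 power_one)
  then have b0: "b \<noteq> 0" by auto
  have dh: "(h has_field_derivative deriv h \<zeta>) (at \<zeta>)" and dB: "(B has_field_derivative deriv B \<zeta>) (at \<zeta>)"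
    using holomorphic_derivI[OF h S(1) mem] holomorphic_derivI[OF B S(1) mem] by auto
  have dcis: "(cis has_vector_derivative \<i> * \<zeta>) (at t0)"
    unfolding \<zeta>_def by (auto intro!: derivative_eq_intros simp: scaleR_conv_of_real has_vector_derivative_def has_derivative_cis)
  have "((\<lambda>t. h (cis t)) has_vector_derivative (\<i> * \<zeta> * deriv h \<zeta>)) (at t0)"
    using field_vector_diff_chain_at[OF dcis, of h] dh by (simp add: o_def \<zeta>_def)
  moreover have "((\<lambda>t. B (cis t)) has_vector_derivative (\<i> * \<zeta> * deriv B \<zeta>)) (at t0)"
    using field_vector_diff_chain_at[OF dcis, of B] dB by (simp add: o_def \<zeta>_def)
  then have "((\<lambda>t. B (cis t) * of_real (F t)) has_vector_derivative
      (B (cis t0) * of_real s + (\<i> * \<zeta> * deriv B \<zeta>) * of_real (F t0))) (at t0)"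
    by (rule has_vector_derivative_mult)
      (use F' in \<open>auto intro!: has_vector_derivative_of_real simp: has_real_derivative_iff_has_vector_derivative\<close>)
  \<comment> \<open>In the product rule the term with the derivative of \<open>B\<close> drops out
    because \<open>F t0 = 0\<close>.\<close>
  ultimately have eq: "\<i> * \<zeta> * deriv h \<zeta> = b * of_real s"
    using vector_derivative_unique_at[of "\<lambda>t. h (cis t)" _ t0] by (simp add: hF F0 b_def \<zeta>_def)
  have dhe: "\<zeta> * deriv h \<zeta> = - \<i> * b * of_real s"
  proof -
    have "\<zeta> * deriv h \<zeta> = - \<i> * (\<i> * \<zeta> * deriv h \<zeta>)" by (simp flip: mult.assoc)
    then show ?thesis by (simp add: eq)
  qed
  define p where "p = \<zeta> * deriv B \<zeta> / B \<zeta>"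
  define \<Theta> where "\<Theta> = Re p"
  have key: "0 \<le> 2 * \<Theta> + 2 * \<sigma> * s / R" if R: "R > 1" and \<sigma>: "\<bar>\<sigma>\<bar> = 1" for R \<sigma> :: real
  proof -
    \<comment> \<open>With this phase of \<open>l\<close> both quotients of
      \<open>\<zeta> * deriv h \<zeta>\<close> below are real. The sign \<open>\<sigma>\<close>
      stays free until the end.\<close>
    define l where "l = - \<i> * of_real (\<sigma> * R) * b"
    have \<sigma>': "\<sigma> = 1 \<or> \<sigma> = - 1" using \<sigma> by auto
    have nl: "norm l = R" using R \<sigma> by (simp add: l_def norm_mult)
    have l0: "l \<noteq> 0" using nl R by auto
    have hl: "norm (h z) \<le> 1" if "norm z \<le> 1" for z
    proof (rule maximum_modulus_frontier[of h "cball 0 1"])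
      show "h holomorphic_on interior (cball 0 1)"
        using h S by (meson holomorphic_on_subset interior_subset order_trans)
      show "continuous_on (closure (cball 0 1)) h"
        using h S by (auto intro: continuous_on_subset holomorphic_on_imp_continuous_on)
      fix z :: complex assume "z \<in> frontier (cball 0 1)"
      then have "norm z = 1" by (auto simp: dist_norm)
      then have "z = cis (Arg z)" by (simp add: cis_Arg_unit)
      then show "norm (h z) \<le> 1" using hF[of "Arg z"] F1[of "Arg z"] B1 \<open>norm z = 1\<close> by (simp add: norm_mult)
    qed (use that in auto)
    \<comment> \<open>On the closed disc |h| \<le> 1 < R = |l|, so removing the points with
      \<open>h z = l\<close> keeps the disc inside the domain. At R = 1 a zero of the denominator on
      the circle could not be excluded.\<close>
    define T where "T = S \<inter> {z \<in> S. h z \<in> - {l}}"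
    have T: "open T" unfolding T_def
      using continuous_open_preimage[OF holomorphic_on_imp_continuous_on[OF h] S(1), of "-{l}"] S(1)
      by (auto simp: vimage_def Int_def)
    have T1: "cball 0 1 \<subseteq> T" using S hl nl R by (fastforce simp: T_def)
    have TS: "T \<subseteq> S" by (auto simp: T_def)
    have nz: "h z - l \<noteq> 0" if "z \<in> T" for z using that by (auto simp: T_def)
    \<comment> \<open>\<open>F\<close> is real, so on the circle the numerator is
      \<open>(B z)^2 * cnj (h z - l)\<close>. Hence \<open>\<Psi>\<close> is unimodular there, and
      its phase cannot run backwards.\<close>
    define \<Psi> where "\<Psi> = (\<lambda>z. (h z - cnj l * (B z)^2) / (h z - l))"
    have hol: "\<Psi> holomorphic_on T"
      unfolding \<Psi>_def using h B TS nz by (auto intro!: holomorphic_intros intro: holomorphic_on_subset)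
    have P1: "norm (\<Psi> z) = 1" if "norm z = 1" for z
    proof -
      have z: "z = cis (Arg z)" using that by (simp add: cis_Arg_unit)
      define f where "f = F (Arg z)"
      have hz: "h z = B z * of_real f" using hF[of "Arg z"] z by (simp add: f_def)
      have cB: "cnj (B z) * B z = 1"
        using B1[OF that] by (metis complex_norm_square mult.commute of_real_1 power_one)
      have "h z - cnj l * (B z)^2 = B z * B z * cnj (h z - l)"
        unfolding hz using cB by (simp add: algebra_simps power2_eq_square)
      then have "norm (h z - cnj l * (B z)^2) = norm (h z - l)" by (simp only: norm_mult B1[OF that] complex_mod_cnj mult_1)
      moreover have "z \<in> T" by (rule subsetD[OF T1]) (simp add: that)
      then have "h z - l \<noteq> 0" by (rule nz)
      ultimately show ?thesis by (simp add: \<Psi>_def norm_divide)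
    qed
    have mT: "\<zeta> \<in> T" using T1 by auto
    have "0 \<le> Re (\<zeta> * deriv \<Psi> \<zeta> / \<Psi> \<zeta>)"
      by (rule Re_log_deriv_ge_0_boundary[OF T T1 hol]) (auto simp: P1)
    also have "deriv \<Psi> \<zeta> = ((deriv h \<zeta> - cnj l * (2 * b * deriv B \<zeta>)) * (h \<zeta> - l) - (h \<zeta> - cnj l * b^2) * deriv h \<zeta>) / (h \<zeta> - l)^2"
      unfolding \<Psi>_def using nz[OF mT]
      by (intro DERIV_imp_deriv) (auto intro!: derivative_eq_intros dh dB simp: b_def power2_eq_square)
    also have "\<zeta> * \<dots> / \<Psi> \<zeta> = 2 * p + (\<zeta> * deriv h \<zeta>) / l - (\<zeta> * deriv h \<zeta>) / (cnj l * b\<^sup>2)"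
      using l0 b0 by (simp add: h0 \<Psi>_def p_def field_simps power2_eq_square b_def[symmetric])
    also have "(\<zeta> * deriv h \<zeta>) / l = of_real (\<sigma> * s / R)"
      using b0 \<sigma>' R unfolding dhe l_def by (auto simp: field_simps)
    also have "(\<zeta> * deriv h \<zeta>) / (cnj l * b\<^sup>2) = - of_real (\<sigma> * s / R)"
    proof -
      have "cnj l * b\<^sup>2 = \<i> * of_real (\<sigma> * R) * (cnj b * b) * b"
        by (simp add: l_def power2_eq_square)
      also have "\<dots> = \<i> * of_real (\<sigma> * R) * b" by (simp only: cb) simp
      finally show ?thesis
        using b0 \<sigma>' R unfolding dhe by (auto simp: field_simps)
    qed
    finally show ?thesis by (simp add: \<Theta>_def)
  qed
  have "\<bar>s\<bar> \<le> \<Theta>"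
  proof (rule ccontr)
    assume "\<not> ?thesis"
    then have lt: "\<Theta> < \<bar>s\<bar>" by simp
    \<comment> \<open>The sign opposite to that of \<open>s\<close> turns \<open>key\<close> into an
      upper bound for |s| / R, and R then tends to 1.\<close>
    define \<sigma> :: real where "\<sigma> = (if s \<ge> 0 then - 1 else 1)"
    have k: "\<bar>s\<bar> / R \<le> \<Theta>" if "R > 1" for R
      using key[OF that, of \<sigma>] by (cases "s \<ge> 0") (auto simp: \<sigma>_def)
    have "((\<lambda>R. \<bar>s\<bar> / R) \<longlongrightarrow> \<bar>s\<bar> / 1) (at_right (1::real))"
      by (intro tendsto_intros) auto
    then have "\<bar>s\<bar> / 1 \<le> \<Theta>"
      by (rule tendsto_upperbound) (auto simp: eventually_at_right_less k intro!: eventually_at_rightI[of 1 2])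
    with lt show False by simp
  qed
  then show ?thesis by (simp add: \<Theta>_def p_def \<zeta>_def)
qed

section \<open>Poisson kernels\<close>

lemma one_minus_cnj_mult_neq_0:
  assumes "norm a < 1" "norm z \<le> 1"
  shows "1 - cnj a * z \<noteq> 0"
proof
  assume "1 - cnj a * z = 0"
  then have "norm (cnj a * z) = 1" by (metis eq_iff_diff_eq_0 norm_one)
  moreover have "norm (cnj a * z) \<le> norm a"
    using assms(2) by (simp add: norm_mult mult_left_le)
  ultimately show False using assms(1) by simp
qed

lemma poisson_kernel_nonneg: "y \<ge> 0 \<Longrightarrow> poisson_kernel y x \<ge> 0"
  unfolding poisson_kernel_def
  using cosh_real_ge_1[of y] cos_le_one[of x] by (intro divide_nonneg_nonneg) (simp, linarith)

text \<open>The kernel is largest at x = 0, where it equals coth (y/2), and coth is decreasing. The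
  factor 2 matches y being a sum of two imaginary parts, each at least c.\<close>

lemma poisson_kernel_le_coth:
  assumes "0 < c" "2 * c \<le> y"
  shows "poisson_kernel y x \<le> coth c"
proof -
  have c: "sinh c > 0" "cosh c > 0" "sinh (y/2) > 0" "cosh (y/2) > 0" using assms by auto
  have d: "cosh y - 1 = 2 * (sinh (y/2))^2" "sinh y = 2 * sinh (y/2) * cosh (y/2)"
    using cosh_double[of "y/2"] sinh_double[of "y/2"] cosh_square_eq[of "y/2"] by auto
  have "cosh y - 1 > 0" using d c by simp
  moreover have "cosh y - cos x \<ge> cosh y - 1" by simp
  moreover from calculation have "cosh y - cos x > 0" by linarith
  ultimately have "poisson_kernel y x \<le> sinh y / (cosh y - 1)"
    unfolding poisson_kernel_def using assms by (intro divide_left_mono mult_pos_pos) auto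
  also have "\<dots> = cosh (y/2) / sinh (y/2)"
    unfolding d using c by (simp add: power2_eq_square field_simps)
  also have "\<dots> \<le> coth c"
  proof -
    have "0 \<le> sinh (y/2 - c)" using assms by simp
    then show ?thesis unfolding coth_def sinh_diff using c by (simp add: field_simps)
  qed
  finally show ?thesis .
qed

text \<open>With r = exp (-y) both sides are the classical (1 - r^2) / (1 - 2 r cos x + r^2). The
  right side exhibits the kernel as the real part of a holomorphic function, to which Cauchy's
  formula applies.\<close>

lemma poisson_kernel_eq:
  fixes w :: complex
  assumes y: "y > 0" and w: "w = exp (- of_real y) * cis x"
  shows "poisson_kernel y x = Re ((1 + w) / (1 - w))"
proof -
  define r where "r = exp (- y)"
  have r: "0 < r" "r < 1" using y by (auto simp: r_def)
  have w': "w = of_real r * cis x" by (simp add: w r_def flip: exp_of_real)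
  have ey: "exp y = 1 / r" by (simp add: r_def exp_minus field_simps)
  have sc: "sinh y = (1/r - r)/2" "cosh y = (1/r + r)/2"
    by (auto simp: sinh_field_def cosh_field_def ey r_def[symmetric])
  have nn: "(1 - r * cos x)^2 + (r * sin x)^2 = 1 - 2 * r * cos x + r^2"
    unfolding power_mult_distrib sin_squared_eq by (simp add: power2_eq_square algebra_simps)
  have "1 - 2 * r * cos x + r^2 \<ge> (1 - r)^2" using cos_le_one[of x] r by (simp add: power2_eq_square algebra_simps)
  then have pos: "1 - 2 * r * cos x + r^2 > 0" using r by (smt (verit) zero_less_power)
  have "Re ((1 + w) / (1 - w)) = ((1 + r * cos x) * (1 - r * cos x) - (r * sin x)^2) / ((1 - r * cos x)^2 + (r * sin x)^2)"
    by (simp add: Re_divide w' power2_eq_square)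
  also have "\<dots> = (1 - r^2) / (1 - 2 * r * cos x + r^2)"
    unfolding nn power_mult_distrib sin_squared_eq by (simp add: power2_eq_square algebra_simps)
  also have "\<dots> = poisson_kernel y x"
  proof -
    have "cosh y - cos x = (1 - 2 * r * cos x + r^2) / (2 * r)" "sinh y = (1 - r^2) / (2 * r)"
      unfolding sc using r by (simp_all add: field_simps power2_eq_square)
    then show ?thesis unfolding poisson_kernel_def using r by simp
  qed
  finally show ?thesis by simp
qed

text \<open>The left side is the logarithmic derivative of a Blaschke factor.\<close>
lemma poisson_kernel_blaschke:
  fixes z w :: complex
  assumes y: "y > 0" and w: "w = exp (- of_real y) * cis x" and z: "z = cis k"
  shows "z / (z - w) + cnj w * z / (1 - cnj w * z) = of_real (poisson_kernel y (k - x))"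
proof -
  \<comment> \<open>As z has modulus 1, the two terms become 1 / (1 - b) and 1 / (1 - cnj b) - 1,
    whose sum is real.\<close>
  define b where "b = w * cnj z"
  have zz: "z * cnj z = 1" by (simp add: z cis_mult cis_cnj)
  have b: "b = exp (- of_real y) * cis (x - k)"
    by (simp add: b_def w z cis_cnj cis_mult)
  have nb: "norm b < 1" using y by (simp add: b norm_mult)
  have "b \<noteq> 1" using nb by auto
  then have b1: "1 - b \<noteq> 0" "1 - cnj b \<noteq> 0" by (metis complex_cnj_one_iff eq_iff_diff_eq_0)+
  have z0: "z \<noteq> 0" by (simp add: z)
  have zw: "z - w = z * (1 - b)" using zz by (simp add: b_def algebra_simps)
  have 1: "z / (z - w) = 1 / (1 - b)" unfolding zw using z0 by simp
  have 2: "cnj w * z = cnj b" by (simp add: b_def)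
  have cb: "1 / (1 - b) + 1 / (1 - cnj b) = of_real (2 * Re (1 / (1 - b)))"
    using complex_add_cnj[of "1 / (1 - b)"] by simp
  define c where "c = 1 / (1 - b)"
  have "z / (z - w) + cnj w * z / (1 - cnj w * z) = c + (1 / (1 - cnj b) - 1)"
    unfolding 1 2 c_def using b1 by (simp add: field_simps)
  also have "\<dots> = of_real (2 * Re c - 1)"
    using cb by (simp add: c_def algebra_simps)
  also have "2 * Re c - 1 = Re (2 * c - 1)" by simp
  also have "2 * c - 1 = (1 + b) / (1 - b)" unfolding c_def using b1 by (simp add: field_simps)
  also have "Re \<dots> = poisson_kernel y (x - k)" using poisson_kernel_eq[OF y b] by simp
  also have "\<dots> = poisson_kernel y (k - x)" unfolding poisson_kernel_def by (metis cos_minus minus_diff_eq)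
  finally show ?thesis .
qed

text \<open>Poisson's formula, applied to the real part of the holomorphic function (1 + cnj b z) / (1 - cnj b z).\<close>
lemma poisson_kernel_convolution:
  assumes y: "y1 > 0" "y2 > 0"
  shows "((\<lambda>k. poisson_kernel y1 (k - x1) * poisson_kernel y2 (k - x2)) has_integral
           2 * pi * poisson_kernel (y1 + y2) (x1 - x2)) {0..2*pi}"
proof -
  define a where "a = exp (- of_real y1) * cis x1"
  define b where "b = exp (- of_real y2) * cis x2"
  have na: "norm a < 1" and nb: "norm b < 1" using y by (auto simp: a_def b_def norm_mult)
  define g where "g = (\<lambda>z. (1 + cnj b * z) / (1 - cnj b * z))"
  have g: "g holomorphic_on cball 0 1"
    unfolding g_def using one_minus_cnj_mult_neq_0[OF nb] by (intro holomorphic_intros) auto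
  \<comment> \<open>Cauchy's formula evaluates \<open>g\<close> at the pole \<open>a\<close>. The
    other half of the logarithmic derivative has no pole in the closed disc and contributes 0; it is
    added so that the weight becomes the real Poisson kernel.\<close>
  have 1: "((\<lambda>u. g u / (u - a)) has_contour_integral (2 * of_real pi * \<i> * g a)) (circlepath 0 1)"
  proof (rule Cauchy_integral_circlepath)
    show "g holomorphic_on ball 0 1" using g by (rule holomorphic_on_subset) auto
  qed (use na g in \<open>auto intro: holomorphic_on_imp_continuous_on\<close>)
  have "((\<lambda>u. g u * (cnj a / (1 - cnj a * u))) has_contour_integral 0) (circlepath 0 1)"
  proof (rule Cauchy_theorem_convex_simple)
    show "(\<lambda>u. g u * (cnj a / (1 - cnj a * u))) holomorphic_on cball 0 1"
      using one_minus_cnj_mult_neq_0[OF na] by (intro holomorphic_intros g) auto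
  qed (auto simp: convex_cball)
  from has_contour_integral_add[OF 1 this]
  have "((\<lambda>u. g u / (u - a) + g u * (cnj a / (1 - cnj a * u))) has_contour_integral (2 * of_real pi * \<i> * g a)) (part_circlepath 0 1 0 (2*pi))"
    by (simp add: circlepath_def)
  then have "((\<lambda>t. (g (cis t) / (cis t - a) + g (cis t) * (cnj a / (1 - cnj a * cis t))) * \<i> * cis t)
      has_integral 2 * of_real pi * \<i> * g a) {0..2*pi}"
    by (subst (asm) has_contour_integral_part_circlepath_iff) auto
  \<comment> \<open>This removes the factor i of du = i u dt.\<close>
  from has_integral_mult_right[OF this, of "- \<i>"]
  have "((\<lambda>t. g (cis t) * (cis t / (cis t - a) + cnj a * cis t / (1 - cnj a * cis t)))
      has_integral 2 * of_real pi * g a) {0..2*pi}"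
    by (simp add: algebra_simps)
  then have "((\<lambda>t. g (cis t) * of_real (poisson_kernel y1 (t - x1))) has_integral 2 * of_real pi * g a) {0..2*pi}"
    by (simp add: poisson_kernel_blaschke[OF y(1) a_def refl])
  from has_integral_Re[OF this]
  have "((\<lambda>t. Re (g (cis t)) * poisson_kernel y1 (t - x1)) has_integral 2 * pi * Re (g a)) {0..2*pi}"
    by simp
  moreover have "Re (g (cis t)) = poisson_kernel y2 (t - x2)" for t
    unfolding g_def
    by (rule poisson_kernel_eq[OF y(2), symmetric]) (simp add: b_def cis_cnj cis_mult exp_cnj)
  \<comment> \<open>\<open>cnj b * a\<close> equals \<open>exp (-(y1 + y2)) * cis (x1 - x2)\<close>,
    so the y add up and the x are subtracted.\<close>
  moreover have "Re (g a) = poisson_kernel (y1 + y2) (x1 - x2)" unfolding g_def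
    by (rule poisson_kernel_eq[symmetric]) (use y in \<open>auto simp: a_def b_def cis_cnj cis_mult exp_cnj exp_add exp_diff exp_minus field_simps\<close>)
  ultimately show ?thesis by (simp add: mult.commute)
qed

section \<open>Blaschke products and Bernstein's inequality for rational functions\<close>

lemma norm_blaschke_factor:
  assumes "norm z = 1"
  shows "norm (1 - cnj a * z) = norm (z - a)"
proof -
  have "z * cnj z = 1" using assms by (metis complex_norm_square of_real_1 power_one)
  then have "1 - cnj a * z = z * cnj (z - a)" by (simp add: algebra_simps)
  then show ?thesis using assms by (simp only: norm_mult complex_mod_cnj mult_1)
qed

text \<open>The poles of F = T / (c q q') inside the disc are among the zeros of q. Multiplication
  by B = q / q' leaves T / (c q'^2), which is holomorphic on a neighbourhood of the closed
  disc.\<close>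

lemma bernstein_rational:
  fixes x y :: "nat \<Rightarrow> real" and F :: "real \<Rightarrow> real" and T :: "complex poly"
  defines "z \<equiv> (\<lambda>l. exp (- of_real (y l)) * cis (x l))"
  assumes y: "\<And>l. l \<in> {1..N} \<Longrightarrow> y l > 0" and c: "c \<noteq> 0"
    and Q: "Q = smult c ((\<Prod>l=1..N. [:- z l, 1:]) * (\<Prod>l=1..N. [:1, - cnj (z l):]))"
    and F: "\<And>t. of_real (F t) * poly Q (cis t) = poly T (cis t)"
    and F1: "\<And>t. \<bar>F t\<bar> \<le> 1" and F0: "F t0 = 0"
    and F': "(F has_real_derivative s) (at t0)"
  shows "\<bar>s\<bar> \<le> (\<Sum>l=1..N. poisson_kernel (y l) (t0 - x l))"
proof -
  define q' where "q' = (\<lambda>w. \<Prod>l=1..N. 1 - cnj (z l) * w)"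
  define B where "B = (\<lambda>w. \<Prod>l=1..N. (w - z l) / (1 - cnj (z l) * w))"
  define h where "h = (\<lambda>w. poly T w / (c * (q' w)\<^sup>2))"
  define S where "S = {w. q' w \<noteq> 0}"
  have nz: "norm (z l) < 1" if "l \<in> {1..N}" for l using y[OF that] by (simp add: z_def norm_mult)
  have "continuous_on UNIV q'" unfolding q'_def by (intro continuous_intros)
  then have S: "open S" unfolding S_def
    using open_Collect_neq[of q' "\<lambda>_. 0"] by (simp add: continuous_on_const)
  have S1: "cball 0 1 \<subseteq> S"
    unfolding S_def q'_def using one_minus_cnj_mult_neq_0[OF nz] by auto
  have Sl: "1 - cnj (z l) * w \<noteq> 0" if "w \<in> S" "l \<in> {1..N}" for w l
    using that by (auto simp: S_def q'_def)
  have h: "h holomorphic_on S" unfolding h_def q'_def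
    by (intro holomorphic_intros) (use c Sl in auto)
  have B: "B holomorphic_on S" unfolding B_def
    by (intro holomorphic_intros) (use Sl in auto)
  have B1: "norm (B w) = 1" if "norm w = 1" for w
  proof -
    have "norm ((w - z l) / (1 - cnj (z l) * w)) = 1" if "l \<in> {1..N}" for l
    proof -
      have "1 - cnj (z l) * w \<noteq> 0"
        using one_minus_cnj_mult_neq_0[OF nz[OF that], of w] \<open>norm w = 1\<close> by simp
      then show ?thesis
        unfolding norm_divide norm_blaschke_factor[OF \<open>norm w = 1\<close>, symmetric] by simp
    qed
    then show ?thesis by (simp add: B_def flip: prod_norm)
  qed
  have "h (cis t) = B (cis t) * of_real (F t)" for t
  proof -
    define q where "q = (\<Prod>l=1..N. cis t - z l)"
    have "cis t \<in> S" by (rule subsetD[OF S1]) simp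
    then have q'0: "q' (cis t) \<noteq> 0" by (simp add: S_def)
    have "poly Q (cis t) = c * (q * q' (cis t))"
      by (simp add: Q poly_prod q_def q'_def algebra_simps)
    then have "poly T (cis t) = of_real (F t) * (c * (q * q' (cis t)))" using F[of t] by simp
    moreover have "B (cis t) = q / q' (cis t)" by (simp add: B_def q_def q'_def prod_dividef)
    ultimately show ?thesis using q'0 c by (simp add: h_def power2_eq_square field_simps)
  qed
  from bernstein_unimodular[OF S S1 h B B1 this F1 F0 F']
  have s: "\<bar>s\<bar> \<le> Re (cis t0 * deriv B (cis t0) / B (cis t0))" by simp
  define w where "w = cis t0"
  let ?g = "\<lambda>l. ((1 * (1 - cnj (z l) * w) - (w - z l) * (- cnj (z l))) / (1 - cnj (z l) * w)\<^sup>2) / ((w - z l) / (1 - cnj (z l) * w))"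
  have alg: "w * (b * u) / b = w * u" if "b \<noteq> 0" for b u :: complex using that by simp
  have "(B has_field_derivative B w * (\<Sum>l=1..N. ?g l)) (at w)"
    unfolding B_def
  proof (rule has_field_derivative_prod')
    fix l assume l: "l \<in> {1..N}"
    have n0: "1 - cnj (z l) * w \<noteq> 0" using one_minus_cnj_mult_neq_0[OF nz[OF l], of w] by (simp add: w_def)
    moreover have "w - z l \<noteq> 0"
      using nz[OF l] norm_cis[of t0] unfolding w_def by (metis eq_iff_diff_eq_0 less_irrefl)
    ultimately show "(w - z l) / (1 - cnj (z l) * w) \<noteq> 0" by simp
    show "((\<lambda>w. (w - z l) / (1 - cnj (z l) * w)) has_field_derivative
      (1 * (1 - cnj (z l) * w) - (w - z l) * (- cnj (z l))) / (1 - cnj (z l) * w)\<^sup>2) (at w)"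
      using n0 by (auto intro!: derivative_eq_intros simp: power2_eq_square)
  qed
  note dB = DERIV_imp_deriv[OF this]
  have Bw: "B w \<noteq> 0" using B1[of w] by (auto simp: w_def)
  have "w * deriv B w / B w = w * (\<Sum>l=1..N. ?g l)"
    unfolding dB by (rule alg[OF Bw])
  then have "w * deriv B w / B w = (\<Sum>l=1..N. w * ?g l)"
    by (simp only: sum_distrib_left)
  \<comment> \<open>The phase speed of a product is the sum of those of its factors, and each factor
    contributes one Poisson kernel.\<close>
  also have "\<dots> = (\<Sum>l=1..N. of_real (poisson_kernel (y l) (t0 - x l)))"
  proof (rule sum.cong[OF refl])
    fix l assume l: "l \<in> {1..N}"
    have n0: "1 - cnj (z l) * w \<noteq> 0" using one_minus_cnj_mult_neq_0[OF nz[OF l], of w] by (simp add: w_def)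
    have n1: "w - z l \<noteq> 0"
      using nz[OF l] norm_cis[of t0] unfolding w_def by (metis eq_iff_diff_eq_0 less_irrefl)
    have "w / (w - z l) + cnj (z l) * w / (1 - cnj (z l) * w) = of_real (poisson_kernel (y l) (t0 - x l))"
      by (rule poisson_kernel_blaschke) (use y l in \<open>auto simp: z_def w_def\<close>)
    moreover have "w * (((1 * p - v * (- b)) / p\<^sup>2) / (v / p)) = w / v + b * w / p"
      if "p \<noteq> 0" "v \<noteq> 0" for p v b :: complex
      using that by (simp add: field_simps power2_eq_square)
    ultimately show "w * (((1 * (1 - cnj (z l) * w) - (w - z l) * (- cnj (z l))) / (1 - cnj (z l) * w)\<^sup>2) / ((w - z l) / (1 - cnj (z l) * w)))
      = of_real (poisson_kernel (y l) (t0 - x l))" using n0 n1 by metis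
  qed
  finally have "Re (w * deriv B w / B w) = (\<Sum>l=1..N. poisson_kernel (y l) (t0 - x l))"
    by simp
  then show ?thesis using s by (simp add: w_def)
qed

section \<open>Adjugate matrices\<close>

lemma adjugate_expand:
  fixes A :: "'a::comm_ring_1^'n^'n"
  shows "adjugate A $ i $ j =
    (\<Sum>\<sigma> | \<sigma> permutes UNIV \<and> \<sigma> j = i. of_int (sign \<sigma>) * (\<Prod>p\<in>UNIV - {j}. A $ p $ \<sigma> p))"
proof -
  have fin: "finite {\<sigma>. \<sigma> permutes (UNIV::'n set)}" by (rule finite_permutations) simp
  have "adjugate A $ i $ j = (\<Sum>\<sigma> | \<sigma> permutes UNIV. of_int (sign \<sigma>) *
      (\<Prod>p\<in>UNIV. if p = j then if \<sigma> p = i then 1 else 0 else A $ p $ \<sigma> p))"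
    by (simp add: adjugate_def det_def)
  also have "\<dots> = (\<Sum>\<sigma> | \<sigma> permutes UNIV. if \<sigma> j = i then of_int (sign \<sigma>) * (\<Prod>p\<in>UNIV - {j}. A $ p $ \<sigma> p) else 0)"
  proof (rule sum.cong[OF refl])
    fix \<sigma> :: "'n \<Rightarrow> 'n"
    show "of_int (sign \<sigma>) * (\<Prod>p\<in>UNIV. if p = j then if \<sigma> p = i then 1 else 0 else A $ p $ \<sigma> p) =
      (if \<sigma> j = i then of_int (sign \<sigma>) * (\<Prod>p\<in>UNIV - {j}. A $ p $ \<sigma> p) else 0)"
      by (subst prod.remove[of UNIV j]) (auto intro!: arg_cong2[where f = "(*)"] prod.cong)
  qed
  also have "\<dots> = (\<Sum>\<sigma> | \<sigma> permutes UNIV \<and> \<sigma> j = i. of_int (sign \<sigma>) * (\<Prod>p\<in>UNIV - {j}. A $ p $ \<sigma> p))"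
    using sum.inter_filter[OF fin, of "\<lambda>\<sigma>. of_int (sign \<sigma>) * (\<Prod>p\<in>UNIV - {j}. A $ p $ \<sigma> p)" "\<lambda>\<sigma>. \<sigma> j = i"]
    by simp
  finally show ?thesis .
qed

text \<open>Laplace expansion with row j replaced by \<open>b\<close>: the permutations are grouped
  by their value at j. Taking a row of \<open>A\<close> for \<open>b\<close> leads to
  \<open>A ** adjugate A\<close>, a unit vector to the diagonal cofactors in the derivative of the
  characteristic polynomial.\<close>

lemma sum_adjugate_expand:
  fixes A :: "'a::comm_ring_1^'n^'n" and b :: "'n \<Rightarrow> 'a"
  shows "(\<Sum>i\<in>UNIV. b i * adjugate A $ i $ j) =
    (\<Sum>\<sigma> | \<sigma> permutes UNIV. of_int (sign \<sigma>) * (b (\<sigma> j) * (\<Prod>p\<in>UNIV - {j}. A $ p $ \<sigma> p)))"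
proof -
  have "(\<Sum>i\<in>UNIV. b i * adjugate A $ i $ j) =
    (\<Sum>i\<in>UNIV. \<Sum>\<sigma> | \<sigma> \<in> {\<sigma>. \<sigma> permutes UNIV} \<and> \<sigma> j = i. of_int (sign \<sigma>) * (b (\<sigma> j) * (\<Prod>p\<in>UNIV - {j}. A $ p $ \<sigma> p)))"
    by (simp add: adjugate_expand sum_distrib_left mult_ac)
  also have "\<dots> = (\<Sum>\<sigma> | \<sigma> permutes UNIV. of_int (sign \<sigma>) * (b (\<sigma> j) * (\<Prod>p\<in>UNIV - {j}. A $ p $ \<sigma> p)))"
    by (rule sum.group) (auto intro: finite_permutations)
  finally show ?thesis .
qed

lemma matrix_mul_adjugate:
  fixes A :: "'a::comm_ring_1^'n^'n"
  shows "A ** adjugate A = mat (det A)"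
proof -
  have "(A ** adjugate A) $ i $ j = (if i = j then det A else 0)" for i j
  proof -
    \<comment> \<open>Row j is overwritten by row i: nothing changes for i = j, and otherwise two
      rows coincide.\<close>
    define B where "B = (\<chi> p. if p = j then row i A else row p A)"
    have "(A ** adjugate A) $ i $ j = (\<Sum>k\<in>UNIV. A $ i $ k * adjugate A $ k $ j)"
      by (simp add: matrix_matrix_mult_def)
    also have "\<dots> = det B"
      unfolding sum_adjugate_expand[of "\<lambda>k. A $ i $ k"] det_def
    proof (intro sum.cong refl arg_cong2[where f = "(*)"])
      fix \<sigma> :: "'n \<Rightarrow> 'n"
      have "(\<Prod>p\<in>UNIV. B $ p $ \<sigma> p) = B $ j $ \<sigma> j * (\<Prod>p\<in>UNIV - {j}. B $ p $ \<sigma> p)"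
        by (rule prod.remove) auto
      also have "\<dots> = A $ i $ \<sigma> j * (\<Prod>p\<in>UNIV - {j}. A $ p $ \<sigma> p)"
        by (intro arg_cong2[where f = "(*)"] prod.cong) (auto simp: B_def row_def)
      finally show "A $ i $ \<sigma> j * (\<Prod>p\<in>UNIV - {j}. A $ p $ \<sigma> p) = (\<Prod>p\<in>UNIV. B $ p $ \<sigma> p)" by simp
    qed
    also have "det B = (if i = j then det A else 0)"
    proof (cases "i = j")
      case True
      then have "B = A" by (auto simp: B_def row_def vec_eq_iff)
      then show ?thesis using True by simp
    next
      case False
      then have "row i B = row j B" by (simp add: B_def row_def vec_eq_iff)
      then show ?thesis using False det_identical_rows[of i j B] by simp
    qed
    finally show ?thesis .
  qed
  then show ?thesis by (simp add: vec_eq_iff mat_def)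
qed

text \<open>Passing to the inverse permutation keeps the sign and exchanges the conditions
  \<open>\<sigma> j = i\<close> and \<open>\<sigma> i = j\<close>.\<close>

lemma adjugate_transpose:
  fixes A :: "'a::comm_ring_1^'n^'n"
  shows "adjugate (transpose A) = transpose (adjugate A)"
proof -
  have "adjugate (transpose A) $ i $ j = adjugate A $ j $ i" for i j
  proof -
    have "adjugate (transpose A) $ i $ j =
      (\<Sum>\<sigma> | \<sigma> permutes UNIV \<and> \<sigma> j = i. of_int (sign \<sigma>) * (\<Prod>p\<in>UNIV - {j}. A $ \<sigma> p $ p))"
      by (simp add: adjugate_expand transpose_def)
    also have "\<dots> = (\<Sum>\<sigma> | \<sigma> permutes UNIV \<and> \<sigma> i = j. of_int (sign \<sigma>) * (\<Prod>p\<in>UNIV - {i}. A $ p $ \<sigma> p))"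
    proof (rule sum.reindex_bij_witness[of _ Hilbert_Choice.inv Hilbert_Choice.inv])
      fix \<sigma> :: "'n \<Rightarrow> 'n" assume "\<sigma> \<in> {\<sigma>. \<sigma> permutes UNIV \<and> \<sigma> j = i}"
      then have s: "\<sigma> permutes UNIV" "\<sigma> j = i" by auto
      show "Hilbert_Choice.inv (Hilbert_Choice.inv \<sigma>) = \<sigma>" using s by (simp add: permutes_inv_inv)
      show "Hilbert_Choice.inv \<sigma> \<in> {\<sigma>. \<sigma> permutes UNIV \<and> \<sigma> i = j}"
        using s by (auto simp: permutes_inv permutes_inverses)
      have "sign (Hilbert_Choice.inv \<sigma>) = sign \<sigma>"
        using s by (intro sign_inverse) (auto intro: permutes_imp_permutation)
      moreover have "(\<Prod>p\<in>UNIV - {i}. A $ p $ Hilbert_Choice.inv \<sigma> p) = (\<Prod>p\<in>UNIV - {j}. A $ \<sigma> p $ p)"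
        by (rule prod.reindex_bij_witness[of _ \<sigma> "Hilbert_Choice.inv \<sigma>"])
          (use s in \<open>auto simp: permutes_inverses inj_eq[OF permutes_inj[OF s(1)]]\<close>)
      ultimately show "of_int (sign (Hilbert_Choice.inv \<sigma>)) * (\<Prod>p\<in>UNIV - {i}. A $ p $ Hilbert_Choice.inv \<sigma> p) =
         of_int (sign \<sigma>) * (\<Prod>p\<in>UNIV - {j}. A $ \<sigma> p $ p)" by simp
    next
      fix \<sigma> :: "'n \<Rightarrow> 'n" assume "\<sigma> \<in> {\<sigma>. \<sigma> permutes UNIV \<and> \<sigma> i = j}"
      then have s: "\<sigma> permutes UNIV" "\<sigma> i = j" by auto
      show "Hilbert_Choice.inv (Hilbert_Choice.inv \<sigma>) = \<sigma>" using s by (simp add: permutes_inv_inv)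
      show "Hilbert_Choice.inv \<sigma> \<in> {\<sigma>. \<sigma> permutes UNIV \<and> \<sigma> j = i}"
        using s by (auto simp: permutes_inv permutes_inverses)
    qed
    also have "\<dots> = adjugate A $ j $ i" by (simp add: adjugate_expand)
    finally show ?thesis .
  qed
  then show ?thesis by (simp add: vec_eq_iff transpose_def)
qed

lemma adjugate_conj_transpose:
  "adjugate (conj_transpose A) = conj_transpose (adjugate A)"
proof -
  have "adjugate (conj_transpose A) $ i $ j = cnj (adjugate (transpose A) $ i $ j)" for i j
    by (simp add: adjugate_expand conj_transpose_def transpose_def)
  then have "adjugate (conj_transpose A) $ i $ j = conj_transpose (adjugate A) $ i $ j" for i j
    unfolding adjugate_transpose by (simp add: conj_transpose_def transpose_def)
  then show ?thesis by (simp add: vec_eq_iff)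
qed

lemma adjugate_scale:
  fixes A :: "'a::comm_ring_1^'n^'n"
  shows "adjugate (\<chi> i j. c * A $ i $ j) $ i $ j = c ^ (CARD('n) - 1) * adjugate A $ i $ j"
  by (simp add: adjugate_expand prod.distrib sum_distrib_left mult_ac card_Diff_singleton)

lemma poly_adjugate:
  fixes A :: "'a::comm_ring_1 poly^'n^'n"
  shows "poly (adjugate A $ i $ j) x = adjugate (\<chi> p q. poly (A $ p $ q) x) $ i $ j"
  by (simp add: adjugate_expand poly_sum poly_prod)

lemma degree_adjugate_le:
  fixes A :: "'a::comm_ring_1 poly^'n^'n"
  assumes "\<And>p q. degree (A $ p $ q) \<le> d"
  shows "degree (adjugate A $ i $ j) \<le> (CARD('n) - 1) * d"
  unfolding adjugate_expand
proof (rule degree_sum_le)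
  fix \<sigma> :: "'n \<Rightarrow> 'n"
  have "degree (of_int (sign \<sigma>) * (\<Prod>p\<in>UNIV - {j}. A $ p $ \<sigma> p)) \<le> degree (\<Prod>p\<in>UNIV - {j}. A $ p $ \<sigma> p)"
    using degree_mult_le[of "of_int (sign \<sigma>)" "\<Prod>p\<in>UNIV - {j}. A $ p $ \<sigma> p"] by simp
  also have "\<dots> \<le> (\<Sum>p\<in>UNIV - {j}. degree (A $ p $ \<sigma> p))"
    using degree_prod_sum_le[of "UNIV - {j}" "\<lambda>p. A $ p $ \<sigma> p"] by (simp add: o_def)
  also have "\<dots> \<le> (\<Sum>p\<in>UNIV - {j}. d)" by (intro sum_mono assms)
  also have "\<dots> = (CARD('n) - 1) * d" by (simp add: card_Diff_singleton)
  finally show "degree (of_int (sign \<sigma>) * (\<Prod>p\<in>UNIV - {j}. A $ p $ \<sigma> p)) \<le> (CARD('n) - 1) * d" .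
qed (simp add: finite_permutations)

lemma poly_charpoly:
  fixes A :: "'a::comm_ring_1^'n^'n"
  shows "poly (charpoly A) x = det (mat x - A)"
  by (simp add: charpoly_def det_def poly_sum poly_prod mat_def if_distrib[of "\<lambda>p. poly p x"] cong: if_cong)

text \<open>In the Leibniz formula the variable occurs only on the diagonal, so differentiating the
  factor in row i keeps the permutations fixing i. At 0 they form the diagonal cofactors of
  -A.\<close>

lemma poly_pderiv_charpoly_0:
  fixes A :: "'a::idom^'n^'n"
  shows "poly (pderiv (charpoly A)) 0 = (-1) ^ (CARD('n) - 1) * trace (adjugate A)"
proof -
  define M where "M = (\<chi> i j. (if i = j then [:0, 1:] else 0) - [:A $ i $ j:])"
  have dM: "pderiv (M $ i $ j) = (if i = j then 1 else 0)" for i j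
    by (simp add: M_def pderiv_diff pderiv_pCons)
  have d0: "pderiv (of_int k :: 'a poly) = 0" for k
    by (simp add: of_int_poly pderiv_pCons)
  have "poly (pderiv (charpoly A)) 0 =
    (\<Sum>\<sigma> | \<sigma> permutes UNIV. of_int (sign \<sigma>) * (\<Sum>i\<in>UNIV. (\<Prod>p\<in>UNIV - {i}. poly (M $ p $ \<sigma> p) 0) * (if i = \<sigma> i then 1 else 0)))"
    by (simp add: charpoly_def M_def[symmetric] det_def higher_pderiv_sum[where n = 1, simplified] pderiv_mult pderiv_prod dM poly_sum poly_prod
        d0 if_distrib[of "\<lambda>p. poly p 0"] cong: if_cong)
  also have "\<dots> = (\<Sum>i\<in>UNIV. \<Sum>\<sigma> | \<sigma> permutes UNIV. of_int (sign \<sigma>) * ((if \<sigma> i = i then 1 else 0) * (\<Prod>p\<in>UNIV - {i}. poly (M $ p $ \<sigma> p) 0)))"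
    by (subst sum.swap) (auto simp: sum_distrib_left intro!: sum.cong)
  also have "\<dots> = (\<Sum>i\<in>UNIV. adjugate (\<chi> p q. poly (M $ p $ q) 0) $ i $ i)"
  proof (rule sum.cong[OF refl])
    fix i :: 'n
    show "(\<Sum>\<sigma> | \<sigma> permutes UNIV. of_int (sign \<sigma>) * ((if \<sigma> i = i then 1 else 0) * (\<Prod>p\<in>UNIV - {i}. poly (M $ p $ \<sigma> p) 0)))
      = adjugate (\<chi> p q. poly (M $ p $ q) 0) $ i $ i"
      using sum_adjugate_expand[of "\<lambda>k. if k = i then 1 else 0" "\<chi> p q. poly (M $ p $ q) 0" i]
      by (simp add: if_distrib[of "\<lambda>x. x * _"] cong: if_cong)
  qed
  also have "(\<chi> p q. poly (M $ p $ q) 0) = (\<chi> p q. (-1) * A $ p $ q)"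
    by (simp add: M_def vec_eq_iff)
  also have "(\<Sum>i\<in>UNIV. adjugate \<dots> $ i $ i) = (-1) ^ (CARD('n) - 1) * trace (adjugate A)"
    by (simp only: adjugate_scale) (simp add: trace_def sum_distrib_left)
  finally show ?thesis .
qed

lemma det_zero_iff_kernel:
  fixes A :: "'a::field^'n^'n"
  shows "det A = 0 \<longleftrightarrow> (\<exists>v. v \<noteq> 0 \<and> A *v v = 0)"
  using invertible_det_nz[of A] matrix_left_invertible_ker[of A] invertible_left_inverse[of A]
  by metis

lemma eigenvalue_iff_det:
  fixes A :: "'a::field^'n^'n"
  shows "eigenvalue A c \<longleftrightarrow> det (mat c - A) = 0"
proof -
  have "(mat c - A) *v v = c *s v - A *v v" for v
    by (simp add: matrix_vector_mult_diff_rdistrib) (simp add: vec_eq_iff matrix_vector_mult_def mat_def if_distrib[of "\<lambda>x. x * _"] cong: if_cong)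
  then show ?thesis unfolding eigenvalue_def det_zero_iff_kernel by (metis eq_iff_diff_eq_0)
qed

text \<open>At a simple root the derivative of the characteristic polynomial does not vanish, and at
  0 it is the trace up to sign. The non-eigenvalue \<open>c\<close> certifies that the polynomial is
  nonzero, so that \<open>order\<close> is meaningful.\<close>

lemma trace_adjugate_nonzero:
  fixes A :: "'a::field_char_0^'n^'n"
  assumes "simple_eigenvalue A 0" "\<not> eigenvalue A c"
  shows "trace (adjugate A) \<noteq> 0"
proof -
  have ch: "poly (charpoly A) c \<noteq> 0"
    using assms(2) by (simp add: poly_charpoly eigenvalue_iff_det)
  have o1: "order 0 (charpoly A) = 1" and r: "poly (charpoly A) 0 = 0"
    using assms(1) by (auto simp: simple_eigenvalue_def poly_charpoly eigenvalue_iff_det)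
  have "pderiv (charpoly A) \<noteq> 0"
  proof
    assume "pderiv (charpoly A) = 0"
    then obtain a where "charpoly A = [:a:]" using pderiv_iszero by blast
    then show False using r ch by simp
  qed
  moreover have "charpoly A \<noteq> 0" using ch by auto
  ultimately have "order 0 (pderiv (charpoly A)) = 0"
    using order_pderiv[of "charpoly A" 0] o1 r ch by auto
  then have "poly (pderiv (charpoly A)) 0 \<noteq> 0"
    using \<open>pderiv (charpoly A) \<noteq> 0\<close> by (simp add: order_root)
  then show ?thesis by (auto simp: poly_pderiv_charpoly_0)
qed

text \<open>Replacing row j of A by the i-th unit row gives an invertible matrix, and it annihilates
  u i times v minus v i times u.\<close>
lemma kernel_collinear:
  fixes A :: "'a::field^'n^'n"
  assumes "adjugate A $ i $ j \<noteq> 0" "A *v u = 0" "A *v v = 0"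
  shows "v $ i *s u = u $ i *s v"
proof -
  define B where "B = (\<chi> p q. if p = j then (if q = i then 1 else 0) else A $ p $ q)"
  have "det B \<noteq> 0" using assms(1) by (simp add: adjugate_def B_def)
  define w where "w = v $ i *s u - u $ i *s v"
  have Aw: "A *v w = 0"
    by (simp add: w_def matrix_vector_mult_diff_distrib vector_scalar_commute assms)
  have "(B *v w) $ p = 0" for p
  proof (cases "p = j")
    case True
    then have "(B *v w) $ p = w $ i" by (simp add: B_def matrix_vector_mult_def if_distrib[of "\<lambda>x. x * _"] cong: if_cong)
    then show ?thesis by (simp add: w_def)
  next
    case False
    then have "(B *v w) $ p = (A *v w) $ p" by (simp add: B_def matrix_vector_mult_def)
    then show ?thesis by (simp add: Aw)
  qed
  then have "B *v w = 0" by (simp add: vec_eq_iff)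
  then have "w = 0" using \<open>det B \<noteq> 0\<close> det_zero_iff_kernel by blast
  then show ?thesis by (simp add: w_def)
qed

section \<open>Projections of rank one\<close>

text \<open>The complex-valued form whose real part is \<open>inner\<close>; it is conjugate-linear
  in the first argument.\<close>

definition cdot :: "complex^'n \<Rightarrow> complex^'n \<Rightarrow> complex" where
  "cdot v w = (\<Sum>i\<in>UNIV. cnj (v $ i) * w $ i)"

lemma cdot_simps [simp]:
  "cdot v (x + y) = cdot v x + cdot v y" "cdot (x + y) v = cdot x v + cdot y v"
  "cdot v (x - y) = cdot v x - cdot v y" "cdot (x - y) v = cdot x v - cdot y v"
  "cdot v (c *s x) = c * cdot v x" "cdot (c *s x) v = cnj c * cdot x v"
  by (simp_all add: cdot_def algebra_simps sum.distrib sum_subtractf sum_distrib_left)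

lemma cdot_axis: "cdot v (axis j 1) = cnj (v $ j)"
  by (simp add: cdot_def axis_def if_distrib[of "\<lambda>x. _ * x"] cong: if_cong)

lemma cnj_cdot: "cnj (cdot v w) = cdot w v"
  by (simp add: cdot_def mult.commute)

lemma cdot_self: "cdot v v = of_real ((norm v)\<^sup>2)"
proof -
  have "cnj z * z = of_real ((norm z)\<^sup>2)" for z by (metis complex_norm_square mult.commute of_real_power)
  then show ?thesis
    by (simp add: cdot_def norm_vec_def L2_set_def sum_nonneg)
qed

lemma hermitian_nth:
  assumes "hermitian A"
  shows "cnj (A $ i $ j) = A $ j $ i"
  using arg_cong[OF assms[unfolded hermitian_def], of "\<lambda>B. B $ j $ i"] by (simp add: conj_transpose_def)

lemma cdot_hermitian:
  assumes "hermitian A"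
  shows "cdot x (A *v y) = cdot (A *v x) y"
proof -
  have "cdot x (A *v y) = (\<Sum>i\<in>UNIV. \<Sum>j\<in>UNIV. cnj (x $ i) * A $ i $ j * y $ j)"
    by (simp add: cdot_def matrix_vector_mult_def sum_distrib_left mult.assoc)
  also have "\<dots> = (\<Sum>j\<in>UNIV. \<Sum>i\<in>UNIV. cnj (x $ i) * A $ i $ j * y $ j)" by (rule sum.swap)
  also have "\<dots> = cdot (A *v x) y"
    by (simp add: cdot_def matrix_vector_mult_def sum_distrib_left sum_distrib_right hermitian_nth[OF assms] mult_ac)
  finally show ?thesis .
qed

text \<open>The form is |Pw|^2, and its difference from |w|^2 is |w - Pw|^2.\<close>

lemma hermitian_idempotent_form_bounds:
  assumes "hermitian P" "P ** P = P"
  shows "0 \<le> Re (cdot w (P *v w))" "Re (cdot w (P *v w)) \<le> (norm w)\<^sup>2"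
proof -
  have PP: "P *v (P *v w) = P *v w" using assms(2) by (simp add: matrix_vector_mul_assoc)
  have 1: "cdot w (P *v w) = cdot (P *v w) (P *v w)"
    using cdot_hermitian[OF assms(1), of w "P *v w"] PP by simp
  then show "0 \<le> Re (cdot w (P *v w))" by (simp add: cdot_self)
  have "cdot (w - P *v w) (w - P *v w) = cdot w w - cdot w (P *v w)"
    using 1 cdot_hermitian[OF assms(1), of w w] by simp
  then have "Re (cdot w w - cdot w (P *v w)) \<ge> 0" by (metis cdot_self Re_complex_of_real zero_le_power2)
  then show "Re (cdot w (P *v w)) \<le> (norm w)\<^sup>2" by (simp add: cdot_self)
qed

lemma matrix_vector_mult_axis:
  fixes A :: "'a::semiring_1^'n^'m"
  shows "(A *v axis j 1) $ i = A $ i $ j"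
  by (simp add: matrix_vector_mult_def axis_def if_distrib[of "\<lambda>x. _ * x"] cong: if_cong)

text \<open>A nonzero cofactor makes the kernel one-dimensional, spanned by a unit vector v. The
  columns of the adjugate lie in it because \<open>A ** adjugate A = 0\<close>, and as the adjugate
  is Hermitian it must be a multiple of \<open>P\<close>. The trace of \<open>P\<close> being 1
  identifies the multiple.\<close>

lemma flat_band_projection:
  fixes A P :: "complex^'n^'n"
  assumes h: "hermitian A" and s: "simple_eigenvalue A 0" "\<not> eigenvalue A c"
    and P: "orthogonal_projection_onto P (eigenspace A 0)"
  obtains v where "cdot v v = 1" "\<And>x. P *v x = cdot v x *s v"
    "\<And>i j. adjugate A $ i $ j = trace (adjugate A) * P $ i $ j"
proof -
  have hP: "hermitian P" and PP: "P ** P = P" and rP: "range ((*v) P) = {v. A *v v = 0}"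
    using P by (auto simp: orthogonal_projection_onto_def eigenspace_def)
  have hadj: "hermitian (adjugate A)"
    using h by (simp add: hermitian_def flip: adjugate_conj_transpose)
  have "trace (adjugate A) \<noteq> 0" by (rule trace_adjugate_nonzero[OF s])
  then obtain i0 j0 where ij: "adjugate A $ i0 $ j0 \<noteq> 0"
    unfolding trace_def by (metis (mono_tags, lifting) sum.neutral)
  have "det A = 0" using s(1) by (auto simp: simple_eigenvalue_def eigenvalue_def det_zero_iff_kernel)
  then have "A ** adjugate A = 0" by (simp add: matrix_mul_adjugate mat_def vec_eq_iff)
  then have Aadj: "A *v (adjugate A *v x) = 0" for x by (simp add: matrix_vector_mul_assoc)
  \<comment> \<open>Column \<open>j0\<close> of the adjugate is a kernel vector, and its entry
    \<open>i0\<close> is the nonzero cofactor.\<close>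
  define v0 where "v0 = adjugate A *v axis j0 1"
  have v0: "A *v v0 = 0" "v0 $ i0 \<noteq> 0"
    using ij by (simp_all add: v0_def Aadj matrix_vector_mult_axis)
  then have nv0: "norm v0 \<noteq> 0" by auto
  define v where "v = of_real (1 / norm v0) *s v0"
  have v1: "cdot v v = 1" using nv0 by (simp only: v_def cdot_simps) (simp add: cdot_self power2_eq_square)
  have Av: "A *v v = 0" by (simp add: v_def vector_scalar_commute v0)
  have vi: "v $ i0 \<noteq> 0" using v0 nv0 by (simp add: v_def)
  have ker: "u = cdot v u *s v" if "A *v u = 0" for u
  proof -
    have "v $ i0 *s u = u $ i0 *s v" by (rule kernel_collinear[OF ij that Av])
    then have "u = (u $ i0 / v $ i0) *s v" using vi by (simp add: vec_eq_iff field_simps)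
    then obtain d where d: "u = d *s v" by blast
    show ?thesis unfolding d by (simp add: v1)
  qed
  have "v \<in> range ((*v) P)" using Av rP by simp
  then obtain z where "v = P *v z" by blast
  then have Pv: "P *v v = v" using PP by (simp add: matrix_vector_mul_assoc)
  have Px: "P *v x = cdot v x *s v" for x
  proof -
    have "A *v (P *v x) = 0" using rP by blast
    from ker[OF this] show ?thesis by (simp add: cdot_hermitian[OF hP] Pv)
  qed
  \<comment> \<open>The conjugation compensates for \<open>d\<close> ending up in the
    conjugate-linear slot of \<open>cdot\<close>.\<close>
  define d where "d = cnj (cdot v (adjugate A *v v))"
  have adjx: "adjugate A *v x = d *s (P *v x)" for x
  proof -
    have "adjugate A *v x = cdot v (adjugate A *v x) *s v" by (rule ker[OF Aadj])
    also have "\<dots> = cdot (adjugate A *v v) x *s v" by (simp add: cdot_hermitian[OF hadj])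
    also have "\<dots> = cdot (cnj d *s v) x *s v" using ker[OF Aadj, of v] by (simp add: d_def)
    also have "\<dots> = d *s (P *v x)" by (simp add: Px vec_eq_iff)
    finally show ?thesis .
  qed
  have adjd: "adjugate A $ i $ j = d * P $ i $ j" for i j
    using arg_cong[OF adjx[of "axis j 1"], of "\<lambda>x. x $ i"] by (simp add: matrix_vector_mult_axis)
  have Pij: "P $ i $ j = v $ i * cnj (v $ j)" for i j
    using arg_cong[OF Px[of "axis j 1"], of "\<lambda>x. x $ i"]
    by (simp add: matrix_vector_mult_axis cdot_axis mult.commute)
  have "trace P = 1" using v1 by (simp add: trace_def Pij cdot_def mult.commute)
  then have "trace (adjugate A) = d"
    by (simp add: trace_def adjd flip: sum_distrib_left)
  then show thesis using that[of v] v1 Px adjd by simp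
qed

section \<open>Derivatives of projections and the quantum metric\<close>

lemma has_vector_derivative_vec_iff:
  fixes f :: "real \<Rightarrow> 'a::real_normed_vector^'n"
  shows "(f has_vector_derivative f') (at k) \<longleftrightarrow>
    (\<forall>i. ((\<lambda>k. f k $ i) has_vector_derivative f' $ i) (at k))"
proof -
  have *: "bounded_linear (\<lambda>x. x *\<^sub>R c)" for c :: "'b::real_normed_vector"
    by (rule bounded_linear_scaleR_left)
  show ?thesis
    unfolding has_vector_derivative_def has_derivative_def
    using * *[of f'] by (auto intro: vec_tendstoI dest: tendsto_vec_nth)
qed

lemma has_vector_derivative_matrix_iff:
  fixes P :: "real \<Rightarrow> 'a::real_normed_vector^'n^'m"
  shows "(P has_vector_derivative P') (at k) \<longleftrightarrow>
    (\<forall>i j. ((\<lambda>k. P k $ i $ j) has_vector_derivative P' $ i $ j) (at k))"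
  unfolding has_vector_derivative_vec_iff by (rule refl)

text \<open>At k the form <w, P k w> - 1 with w = v + u / |u| and u = P' v vanishes and has slope 2 |u|,
  while the trace of the squared derivative is 2 |u|^2.\<close>
lemma quantum_metric_le:
  fixes P :: "real \<Rightarrow> complex^'n^'n" and v :: "complex^'n"
  assumes P: "\<And>k. hermitian (P k)" "\<And>k. P k ** P k = P k"
    and v: "cdot v v = 1" "\<And>x. P k *v x = cdot v x *s v"
    and P': "(P has_vector_derivative P') (at k)"
    and F: "\<And>w F'. (norm w)\<^sup>2 = 2 \<Longrightarrow> Re (cdot w (P k *v w)) = 1 \<Longrightarrow>
      ((\<lambda>k. Re (cdot w (P k *v w)) - 1) has_real_derivative F') (at k) \<Longrightarrow> \<bar>F'\<bar> \<le> \<Theta>"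
    and \<Theta>: "\<Theta> \<ge> 0"
  shows "quantum_metric P k \<le> 1/4 * \<Theta>\<^sup>2"
proof -
  have d: "((\<lambda>k. P k $ i $ j) has_vector_derivative P' $ i $ j) (at k)" for i j
    using P' by (simp add: has_vector_derivative_matrix_iff)
  have "cnj (P' $ j $ i) = P' $ i $ j" for i j
  proof -
    have eq: "(\<lambda>k. P k $ i $ j) = (\<lambda>k. cnj (P k $ j $ i))"
    proof
      fix k show "P k $ i $ j = cnj (P k $ j $ i)"
        using hermitian_nth[OF P(1), of k j i] by simp
    qed
    have "((\<lambda>k. P k $ i $ j) has_vector_derivative cnj (P' $ j $ i)) (at k)"
      unfolding eq by (rule has_vector_derivative_cnj[OF d])
    then show ?thesis using d[of i j] by (rule vector_derivative_unique_at)
  qed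
  then have hP': "hermitian P'" by (simp add: hermitian_def conj_transpose_def vec_eq_iff)
  \<comment> \<open>This is the derivative of P^2 = P. Applied to v it forces u to be orthogonal to
    v.\<close>
  have "P' = P k ** P' + P' ** P k"
  proof -
    have "P' $ i $ j = (P k ** P' + P' ** P k) $ i $ j" for i j
    proof -
      have "((\<lambda>k. \<Sum>l\<in>UNIV. P k $ i $ l * P k $ l $ j) has_vector_derivative
         (\<Sum>l\<in>UNIV. P k $ i $ l * P' $ l $ j + P' $ i $ l * P k $ l $ j)) (at k)"
        by (intro has_vector_derivative_sum has_vector_derivative_mult d)
      moreover have "(\<Sum>l\<in>UNIV. P k $ i $ l * P k $ l $ j) = P k $ i $ j" for k
        using arg_cong[OF P(2)[of k], of "\<lambda>B. B $ i $ j"] by (simp add: matrix_matrix_mult_def)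
      ultimately have "((\<lambda>k. P k $ i $ j) has_vector_derivative (P k ** P' + P' ** P k) $ i $ j) (at k)"
        by (simp add: matrix_matrix_mult_def sum.distrib)
      then show ?thesis using d[of i j] by (rule vector_derivative_unique_at[symmetric])
    qed
    then show ?thesis by (simp add: vec_eq_iff)
  qed
  then have P'x: "P' *v x = P k *v (P' *v x) + P' *v (P k *v x)" for x
    by (metis matrix_vector_mul_assoc matrix_vector_mult_add_rdistrib)
  define u where "u = P' *v v"
  have Pv: "P k *v v = v" by (simp add: v)
  have "u = cdot v u *s v + u" using P'x[of v] by (simp add: v u_def)
  moreover have "v \<noteq> 0" using v(1) by (auto simp: cdot_def)
  ultimately have vu: "cdot v u = 0" by simp
  then have uv: "cdot u v = 0" by (metis cnj_cdot complex_cnj_zero)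
  have P'x: "P' *v x = cdot u x *s v + cdot v x *s u" for x
    using P'x[of x] by (simp add: v cdot_hermitian[OF hP'] u_def[symmetric] vector_scalar_commute)
  have P'ij: "P' $ i $ j = v $ i * cnj (u $ j) + u $ i * cnj (v $ j)" for i j
    using arg_cong[OF P'x[of "axis j 1"], of "\<lambda>x. x $ i"]
    by (simp add: matrix_vector_mult_axis cdot_axis mult.commute)
  \<comment> \<open>The four products separate into sums over i and over j; orthogonality of u and v
    kills the first and the last.\<close>
  have alg: "(vi * cuj + ui * cvj) * (vj * cui + uj * cvi) =
      (cui * vi) * (cuj * vj) + (cvi * vi) * (cuj * uj) + (cui * ui) * (cvj * vj) + (cvi * ui) * (cvj * uj)"
    for vi ui vj uj cvi cui cvj cuj :: complex
    by (simp add: algebra_simps)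
  have "trace (P' ** P') = (\<Sum>i\<in>UNIV. \<Sum>j\<in>UNIV. P' $ i $ j * P' $ j $ i)"
    by (simp add: trace_def matrix_matrix_mult_def)
  also have "\<dots> = (\<Sum>i\<in>UNIV. \<Sum>j\<in>UNIV. (cnj (u $ i) * v $ i) * (cnj (u $ j) * v $ j)
      + (cnj (v $ i) * v $ i) * (cnj (u $ j) * u $ j) + (cnj (u $ i) * u $ i) * (cnj (v $ j) * v $ j)
      + (cnj (v $ i) * u $ i) * (cnj (v $ j) * u $ j))"
    unfolding P'ij by (intro sum.cong refl alg)
  also have "\<dots> = cdot u v * cdot u v + cdot v v * cdot u u + cdot u u * cdot v v + cdot v u * cdot v u"
    unfolding cdot_def sum_product sum.distrib by (rule refl)
  also have "\<dots> = of_real (2 * (norm u)\<^sup>2)" using v(1) uv vu by (simp add: cdot_self)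
  finally have qm: "quantum_metric P k = (norm u)\<^sup>2"
    using vector_derivative_at[OF P'] by (simp add: quantum_metric_def)
  show ?thesis
  proof (cases "u = 0")
    case True
    then show ?thesis by (simp add: qm)
  next
    case False
    define r where "r = norm u"
    have r: "r > 0" using False by (simp add: r_def)
    \<comment> \<open>Here \<open>P' *v w\<close> is r times \<open>w\<close>: an eigenvector of P'
      made of two orthogonal unit vectors, whence the squared norm 2.\<close>
    define w where "w = v + of_real (1 / r) *s u"
    have uu: "cdot u u = of_real (r\<^sup>2)" by (simp add: cdot_self r_def)
    have "cdot w w = 2" using r by (simp add: w_def v(1) uv vu uu power2_eq_square)
    then have nw: "(norm w)\<^sup>2 = 2" by (metis cdot_self of_real_eq_iff of_real_numeral)
    have vw: "cdot v w = 1" "cdot w v = 1" by (simp_all add: w_def v(1) vu uv)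
    have uw: "cdot u w = of_real r" "cdot w u = of_real r"
      using r by (simp_all add: w_def uv vu uu power2_eq_square)
    have "Re (cdot w (P k *v w)) = 1" by (simp add: v vw)
    moreover have "((\<lambda>k. Re (cdot w (P k *v w)) - 1) has_real_derivative Re (cdot w (P' *v w))) (at k)"
    proof -
      have "((\<lambda>k. cdot w (P k *v w)) has_vector_derivative cdot w (P' *v w)) (at k)"
        unfolding cdot_def matrix_vector_mult_def
        by (auto intro!: has_vector_derivative_sum has_vector_derivative_mult_right has_vector_derivative_mult_left d)
      from has_vector_derivative_diff[OF has_field_derivative_Re[OF this, unfolded has_real_derivative_iff_has_vector_derivative] has_vector_derivative_const[of 1]]
      show ?thesis by (simp add: has_real_derivative_iff_has_vector_derivative)
    qed
    ultimately have "\<bar>Re (cdot w (P' *v w))\<bar> \<le> \<Theta>" by (rule F[OF nw])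
    moreover have "cdot w (P' *v w) = of_real (2 * r)" by (simp add: P'x vw uw)
    ultimately have "2 * r \<le> \<Theta>" by simp
    then have "(2 * r)\<^sup>2 \<le> \<Theta>\<^sup>2" using r by (intro power_mono) auto
    then show ?thesis by (simp add: qm r_def[symmetric] power_mult_distrib)
  qed
qed

section \<open>Self-reciprocal polynomials and the zeros of the denominator\<close>

lemma poly_eq_if_eq_on_circle:
  fixes p q :: "complex poly"
  assumes "\<And>z. norm z = 1 \<Longrightarrow> poly p z = poly q z"
  shows "p = q"
proof -
  have "inj_on cis {0..1}"
  proof (rule inj_onI)
    fix s t :: real assume st: "s \<in> {0..1}" "t \<in> {0..1}" and e: "cis s = cis t"
    have eq: "exp (\<i> * complex_of_real s) = exp (\<i> * of_real t)" by (rule e[unfolded cis_conv_exp])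
    have "0 \<le> s" "s \<le> 1" "0 \<le> t" "t \<le> 1" using st by auto
    then have d: "\<bar>s - t\<bar> < 2 * pi" using pi_gt3 by linarith
    have "\<i> * complex_of_real s = \<i> * complex_of_real t"
      by (rule exp_complex_eqI[OF _ eq]) (simp only: Im_i_times Re_complex_of_real d)
    then show "s = t" by simp
  qed
  then have "infinite (cis ` {0..1})" by (metis finite_imageD infinite_Icc zero_less_one)
  moreover have "cis ` {0..1} \<subseteq> {z. poly (p - q) z = 0}"
  proof
    fix z assume "z \<in> cis ` {0..1}"
    then have "norm z = 1" by auto
    from assms[OF this] show "z \<in> {z. poly (p - q) z = 0}" by simp
  qed
  ultimately have inf: "infinite {z. poly (p - q) z = 0}" by (rule infinite_super[rotated])
  have "p - q = 0" by (rule ccontr) (rule inf[THEN notE, OF poly_roots_finite])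
  then show ?thesis by simp
qed

lemma order_linear_factor: "order w [:- a, 1::'a::idom:] = (if w = a then 1 else 0)"
proof (cases "w = a")
  case True
  then show ?thesis using order_power_n_n[of a 1] by simp
next
  case False
  then show ?thesis by (simp add: order_0I)
qed

text \<open>Roots are split off one at a time. Comparing multiplicities, rather than mere vanishing,
  allows \<open>z\<close> to repeat values.\<close>

lemma prod_linear_factors_dvd:
  fixes p :: "'a::idom poly"
  assumes "finite A" "p \<noteq> 0" "\<And>w. card {l\<in>A. z l = w} \<le> order w p"
  shows "(\<Prod>l\<in>A. [:- z l, 1:]) dvd p"
  using assms
proof (induction A arbitrary: p rule: finite_induct)
  case (insert l A)
  have card: "card {k\<in>insert l A. z k = w} = (if w = z l then 1 else 0) + card {k\<in>A. z k = w}" for w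
  proof -
    have "{k\<in>insert l A. z k = w} = (if w = z l then insert l {k\<in>A. z k = w} else {k\<in>A. z k = w})"
      by auto
    then show ?thesis using insert.hyps by simp
  qed
  have "order (z l) p \<noteq> 0" using insert.prems(2)[of "z l"] unfolding card by simp
  then have "poly p (z l) = 0" by (metis order_0I)
  then obtain r where r: "p = [:- z l, 1:] * r" by (auto simp: poly_eq_0_iff_dvd)
  have "r \<noteq> 0" using r insert.prems(1) by auto
  moreover have "card {k\<in>A. z k = w} \<le> order w r" for w
    using insert.prems(2)[of w] insert.prems(1) order_linear_factor[of w "z l"]
    unfolding r card by (subst (asm) order_mult) (auto split: if_splits)
  ultimately have "(\<Prod>l\<in>A. [:- z l, 1:]) dvd r" by (rule insert.IH)
  then show ?case unfolding r prod.insert[OF insert.hyps] by (rule mult_dvd_mono[OF dvd_refl])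
qed simp

text \<open>This is z^N cnj (p (1 / cnj z)) as a polynomial. The reversal is about the fixed
  \<open>N\<close>, not about the degree of \<open>p\<close>, which may be smaller.\<close>

definition conj_reflect :: "nat \<Rightarrow> complex poly \<Rightarrow> complex poly" where
  "conj_reflect N p = (\<Sum>i\<le>N. monom (cnj (poly.coeff p i)) (N - i))"

lemma degree_conj_reflect_le: "degree (conj_reflect N p) \<le> N"
  unfolding conj_reflect_def
  by (intro degree_sum_le) (auto intro: order_trans[OF degree_monom_le])

lemma poly_conj_reflect:
  assumes "degree p \<le> N" "norm z = 1"
  shows "poly (conj_reflect N p) z = z ^ N * cnj (poly p z)"
proof -
  have zz: "z * cnj z = 1" using assms(2) by (metis complex_norm_square of_real_1 power_one)
  have "poly p z = (\<Sum>i\<le>N. poly.coeff p i * z ^ i)" unfolding poly_altdef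
    by (rule sum.mono_neutral_left) (use assms in \<open>auto simp: coeff_eq_0\<close>)
  then have "z ^ N * cnj (poly p z) = (\<Sum>i\<le>N. cnj (poly.coeff p i) * (z ^ N * cnj z ^ i))"
    by (simp add: sum_distrib_left mult_ac)
  also have "\<dots> = (\<Sum>i\<le>N. cnj (poly.coeff p i) * z ^ (N - i))"
  proof (intro sum.cong refl arg_cong2[where f = "(*)"])
    fix i assume "i \<in> {..N}"
    then have "z ^ N = z ^ (N - i) * z ^ i" by (simp flip: power_add)
    then show "z ^ N * cnj z ^ i = z ^ (N - i)" by (simp only: mult.assoc power_mult_distrib[symmetric] zz) simp
  qed
  finally show ?thesis by (simp add: conj_reflect_def poly_sum poly_monom)
qed

text \<open>Write Q = q R with q carrying the zeros in the disc. Self-reciprocity also gives Q = q'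
  times the reflection of R. As q' has no zero at any \<open>z l\<close>, the reflection must
  contain q as well.\<close>

lemma self_reciprocal_factorization:
  fixes Q :: "complex poly" and z :: "nat \<Rightarrow> complex"
  assumes Q: "Q \<noteq> 0" "degree Q \<le> 2 * N"
    and self: "\<And>\<zeta>. norm \<zeta> = 1 \<Longrightarrow> poly Q \<zeta> = \<zeta> ^ (2 * N) * cnj (poly Q \<zeta>)"
    and z: "\<And>l. l \<in> {1..N} \<Longrightarrow> norm (z l) < 1"
    and ord: "\<And>w. card {l\<in>{1..N}. z l = w} \<le> order w Q"
  shows "\<exists>c. c \<noteq> 0 \<and> Q = smult c ((\<Prod>l=1..N. [:- z l, 1:]) * (\<Prod>l=1..N. [:1, - cnj (z l):]))"
proof -
  define q where "q = (\<Prod>l=1..N. [:- z l, 1:])"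
  define q' where "q' = (\<Prod>l=1..N. [:1, - cnj (z l):])"
  have dq: "degree q = N" unfolding q_def by (subst degree_prod_sum_eq) auto
  have q0: "q \<noteq> 0" by (auto simp: q_def)
  have "q dvd Q" unfolding q_def by (rule prod_linear_factors_dvd) (use Q ord in auto)
  then obtain R where R: "Q = q * R" by blast
  have R0: "R \<noteq> 0" using R Q by auto
  have dR: "degree R \<le> N" using Q(2) R0 q0 by (simp add: R degree_mult_eq dq)
  have Q': "Q = q' * conj_reflect N R"
  proof (rule poly_eq_if_eq_on_circle)
    fix \<zeta> :: complex assume n: "norm \<zeta> = 1"
    then have zz: "\<zeta> * cnj \<zeta> = 1" by (metis complex_norm_square of_real_1 power_one)
    have "poly q' \<zeta> = (\<Prod>l=1..N. \<zeta> * cnj (\<zeta> - z l))"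
      by (simp add: q'_def poly_prod algebra_simps zz)
    also have "\<dots> = \<zeta> ^ N * cnj (poly q \<zeta>)" by (simp add: q_def poly_prod prod.distrib)
    finally have "poly q' \<zeta> = \<zeta> ^ N * cnj (poly q \<zeta>)" .
    then have "\<zeta> ^ (2 * N) * cnj (poly (q * R) \<zeta>) = poly (q' * conj_reflect N R) \<zeta>"
      by (simp add: poly_conj_reflect[OF dR n] mult_2 power_add)
    then show "poly Q \<zeta> = poly (q' * conj_reflect N R) \<zeta>"
      using self[OF n] unfolding R by (rule trans[rotated])
  qed
  have "card {l\<in>{1..N}. z l = w} \<le> order w (conj_reflect N R)" for w
  proof (cases "{l\<in>{1..N}. z l = w} = {}")
    case False
    then have w: "norm w < 1" using z by auto
    have "1 - cnj (z l) * w \<noteq> 0" if "l \<in> {1..N}" for l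
      using one_minus_cnj_mult_neq_0[OF z[OF that]] w by simp
    then have "poly q' w \<noteq> 0" by (simp add: q'_def poly_prod algebra_simps)
    then have "order w q' = 0" by (rule order_0I)
    then show ?thesis using ord[of w] Q(1) unfolding Q' by (simp add: order_mult)
  next
    case True
    then show ?thesis by (metis card.empty zero_le)
  qed
  moreover have S0: "conj_reflect N R \<noteq> 0" using Q(1) Q' by auto
  ultimately have "q dvd conj_reflect N R" unfolding q_def by (intro prod_linear_factors_dvd) auto
  then obtain S where S: "conj_reflect N R = q * S" by blast
  have "S \<noteq> 0" using S S0 by auto
  \<comment> \<open>The reflection has degree at most N, and q already uses all of it.\<close>
  then have "degree S = 0" using degree_conj_reflect_le[of N R] q0 by (simp add: S degree_mult_eq dq)
  then obtain c where c: "S = [:c:]" by (rule degree_eq_zeroE)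
  then have "Q = smult c (q * q')" by (simp add: Q' S mult_ac)
  moreover have "c \<noteq> 0" using \<open>S \<noteq> 0\<close> c by auto
  ultimately show ?thesis unfolding q_def q'_def by blast
qed

text \<open>The map k to exp (i k) has nonzero derivative, hence preserves multiplicities, and the
  exponential prefactor has no zeros.\<close>

lemma zorder_poly_exp:
  fixes Q :: "complex poly"
  assumes "Q \<noteq> 0"
  shows "zorder (\<lambda>k. exp (- (\<i> * of_nat N * k)) * poly Q (exp (\<i> * k))) z = int (order (exp (\<i> * z)) Q)"
proof -
  define w where "w = exp (\<i> * z)"
  define n where "n = order w Q"
  obtain R where R: "Q = [:- w, 1:] ^ n * R" "\<not> [:- w, 1:] dvd R"
    using order_decomp[OF assms, of w] by (auto simp: n_def)
  have Rw: "poly R w \<noteq> 0" using R(2) by (simp add: poly_eq_0_iff_dvd)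
  define f where "f = (\<lambda>k::complex. exp (\<i> * k))"
  \<comment> \<open>The difference quotient of f, extended holomorphically over z, is the factor in
    f k - w = u k (k - z).\<close>
  define u where "u = (\<lambda>k. if k = z then deriv f z else (f k - f z) / (k - z))"
  have u: "u holomorphic_on UNIV" unfolding u_def
    by (rule pole_lemma) (auto simp: f_def intro!: holomorphic_intros)
  have "(f has_field_derivative \<i> * w) (at z)"
    unfolding f_def w_def by (auto intro!: derivative_eq_intros)
  then have uz: "u z \<noteq> 0" by (simp add: u_def DERIV_imp_deriv w_def)
  define g where "g = (\<lambda>k. exp (- (\<i> * of_nat N * k)) * (u k ^ n * poly R (f k)))"
  have "zorder (\<lambda>k. exp (- (\<i> * of_nat N * k)) * poly Q (exp (\<i> * k))) z = int n"
  proof (rule zorder_eqI[of UNIV z g])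
    show "g holomorphic_on UNIV" unfolding g_def f_def
      by (intro holomorphic_intros u)
    show "g z \<noteq> 0" using uz Rw by (simp add: g_def f_def w_def)
    fix k assume "k \<noteq> z"
    then have "f k - w = u k * (k - z)" by (simp add: u_def f_def w_def)
    moreover have "poly Q (f k) = (f k - w) ^ n * poly R (f k)"
      by (simp add: R(1) poly_power)
    ultimately have "poly Q (f k) = (u k * (k - z)) ^ n * poly R (f k)" by simp
    then show "exp (- (\<i> * of_nat N * k)) * poly Q (exp (\<i> * k)) = g k * (k - z) powi int n"
      by (simp add: g_def f_def power_mult_distrib)
  qed auto
  then show ?thesis by (simp add: n_def w_def)
qed

section \<open>The Bloch Hamiltonian as a polynomial matrix in exp (i k)\<close>

definition bloch_poly :: "(int \<Rightarrow> complex^'n^'n) \<Rightarrow> nat \<Rightarrow> complex poly^'n^'n" where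
  "bloch_poly a m = (\<chi> p q. \<Sum>l = - int m..int m. monom (a l $ p $ q) (nat (l + int m)))"

lemma degree_bloch_poly_le: "degree (bloch_poly a m $ p $ q) \<le> 2 * m"
  unfolding bloch_poly_def vec_lambda_beta
  by (intro degree_sum_le) (auto intro: order_trans[OF degree_monom_le])

lemma poly_bloch_poly:
  "poly (bloch_poly a m $ p $ q) (exp (\<i> * k)) = exp (\<i> * of_nat m * k) * bloch_hamiltonian a m k $ p $ q"
proof -
  have "exp (\<i> * k) ^ nat (l + int m) = exp (\<i> * of_nat m * k) * exp (\<i> * of_int l * k)"
    if "l \<in> {- int m..int m}" for l
  proof -
    have n: "of_nat (nat (l + int m)) = (of_int l + of_nat m :: complex)"
      using that by (simp add: of_nat_nat)
    have "exp (\<i> * k) ^ nat (l + int m) = exp (of_nat (nat (l + int m)) * (\<i> * k))"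
      by (simp only: exp_of_nat_mult)
    also have "\<dots> = exp (\<i> * of_nat m * k + \<i> * of_int l * k)"
      unfolding n by (simp add: algebra_simps)
    finally show ?thesis by (simp only: exp_add)
  qed
  then show ?thesis
    by (simp add: bloch_poly_def bloch_hamiltonian_def poly_sum poly_monom sum_distrib_left mult_ac)
qed

text \<open>Each term of a cofactor has n - 1 entries as factors, so clearing the negative powers of
  z by z^m in every entry costs z^N in the adjugate.\<close>

lemma poly_adjugate_bloch_poly:
  fixes a :: "int \<Rightarrow> complex^'n^'n"
  shows "poly (adjugate (bloch_poly a m) $ i $ j) (exp (\<i> * k)) =
    exp (\<i> * of_nat ((CARD('n) - 1) * m) * k) * adjugate (bloch_hamiltonian a m k) $ i $ j"
proof -
  have "poly (adjugate (bloch_poly a m) $ i $ j) (exp (\<i> * k)) =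
    exp (\<i> * of_nat m * k) ^ (CARD('n) - 1) * adjugate (bloch_hamiltonian a m k) $ i $ j"
    by (simp only: poly_adjugate poly_bloch_poly adjugate_scale)
  also have "exp (\<i> * of_nat m * k) ^ (CARD('n) - 1) = exp (of_nat (CARD('n) - 1) * (\<i> * of_nat m * k))"
    by (simp only: exp_of_nat_mult)
  also have "of_nat (CARD('n) - 1) * (\<i> * of_nat m * k) = \<i> * of_nat ((CARD('n) - 1) * m) * k"
    by (simp only: of_nat_mult mult_ac)
  finally show ?thesis .
qed

text \<open>Two points have the same image under exp (i k) exactly when they differ by a multiple of
  2 pi, so the count modulo 2 pi is the count of equal z_l. Where some z_l equals \<open>w\<close>,
  the count is the multiplicity of the zero; elsewhere it is 0.\<close>

lemma card_upper_zeros_le_order: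
  fixes D :: "complex \<Rightarrow> complex"
  assumes L: "lists_upper_zeros D N x y" and Q: "Q \<noteq> 0"
    and D: "D = (\<lambda>k. exp (- (\<i> * of_nat M * k)) * poly Q (exp (\<i> * k)))"
  shows "card {l\<in>{1..N}. exp (- of_real (y l)) * cis (x l) = w} \<le> order w Q"
proof (cases "{l\<in>{1..N}. exp (- of_real (y l)) * cis (x l) = w} = {}")
  case True
  then show ?thesis by (metis card.empty zero_le)
next
  case False
  have e: "exp (- of_real (y l)) * cis (x l) = exp (\<i> * Complex (x l) (y l))" for l
    by (simp add: Complex_eq cis_conv_exp algebra_simps flip: exp_add)
  from False obtain j where j: "j \<in> {1..N}" "w = exp (\<i> * Complex (x j) (y j))" unfolding e by auto
  have "exp (\<i> * Complex (x l) (y l)) = w \<longleftrightarrow>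
    (\<exists>q::int. Complex (x j) (y j) = Complex (x l) (y l) + of_real (2 * pi * of_int q))" for l
  proof -
    have "exp (\<i> * Complex (x l) (y l)) = w \<longleftrightarrow>
      (\<exists>n::int. \<i> * Complex (x j) (y j) = \<i> * Complex (x l) (y l) + (of_int (2 * n) * pi) * \<i>)"
      unfolding j(2) using exp_eq by metis
    also have "\<dots> \<longleftrightarrow> (\<exists>n::int. Complex (x j) (y j) = Complex (x l) (y l) + of_real (2 * pi * of_int n))"
      by (rule ex_cong1) (auto simp: complex_eq_iff)
    finally show ?thesis .
  qed
  then have "int (card {l\<in>{1..N}. exp (\<i> * Complex (x l) (y l)) = w}) = zorder D (Complex (x j) (y j))"
    using L j(1) by (simp add: lists_upper_zeros_def)
  also have "\<dots> = int (order w Q)" unfolding D j(2) by (rule zorder_poly_exp[OF Q])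
  finally show ?thesis unfolding e by simp
qed

lemma quantum_metric_bound:
  fixes a :: "int \<Rightarrow> complex^'n^'n" and P :: "real \<Rightarrow> complex^'n^'n"
    and m N :: nat and x y :: "nat \<Rightarrow> real"
  defines "H \<equiv> bloch_hamiltonian a m" and "N \<equiv> (CARD('n) - 1) * m"
  assumes herm: "\<And>k::real. hermitian (H (of_real k))"
    and flat: "isolated_flat_band_at_zero H"
    and P: "\<And>k::real. orthogonal_projection_onto (P k) (eigenspace (H (of_real k)) 0)"
    and L: "lists_upper_zeros (flat_band_denominator H) N x y"
  shows "quantum_metric P k \<le> 1/4 * (\<Sum>l=1..N. poisson_kernel (y l) (k - x l))\<^sup>2"
proof -
  define D where "D = flat_band_denominator H"
  define A where "A = (\<lambda>i j. adjugate (bloch_poly a m) $ i $ j)"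
  define Q where "Q = (\<Sum>i\<in>UNIV. A i i)"
  define z where "z = (\<lambda>l. exp (- of_real (y l)) * cis (x l))"
  have y: "y l > 0" if "l \<in> {1..N}" for l using L that by (simp add: lists_upper_zeros_def)
  have simple: "simple_eigenvalue (H (of_real k)) 0" for k :: real
    using flat by (simp add: isolated_flat_band_at_zero_def)
  obtain d where d: "d > 0" "\<And>(k::real) c. eigenvalue (H (of_real k)) c \<Longrightarrow> c \<noteq> 0 \<Longrightarrow> d \<le> cmod c"
    using flat by (auto simp: isolated_flat_band_at_zero_def)
  \<comment> \<open>Half the gap lies strictly between the flat band and all other
    eigenvalues.\<close>
  have nev: "\<not> eigenvalue (H (of_real k)) (of_real (d / 2))" for k :: real
  proof
    assume "eigenvalue (H (of_real k)) (of_real (d / 2))"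
    then have "d \<le> cmod (of_real (d / 2))" using d by (intro d(2)) auto
    then show False using d(1) by (simp add: norm_divide)
  qed
  have A: "poly (A i j) (exp (\<i> * k)) = exp (\<i> * of_nat N * k) * adjugate (H k) $ i $ j" for i j k
    unfolding A_def H_def N_def by (rule poly_adjugate_bloch_poly)
  have Qk: "poly Q (exp (\<i> * k)) = exp (\<i> * of_nat N * k) * D k" for k
    by (simp add: Q_def poly_sum A D_def flat_band_denominator_def trace_def sum_distrib_left)
  have Dk: "D = (\<lambda>k. exp (- (\<i> * of_nat N * k)) * poly Q (exp (\<i> * k)))"
    by (simp add: Qk fun_eq_iff flip: mult.assoc exp_add)
  have cis: "cis t = exp (\<i> * of_real t)" for t by (rule cis_conv_exp)
  have D0: "D (of_real k) \<noteq> 0" for k :: real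
    unfolding D_def flat_band_denominator_def by (rule trace_adjugate_nonzero[OF simple nev])
  have Q0: "poly Q (cis t) \<noteq> 0" for t using D0[of t] by (simp add: cis Qk)
  have PQ: "P t $ i $ j * poly Q (cis t) = poly (A i j) (cis t)" for t i j
  proof -
    obtain v where "cdot v v = 1" "\<And>x. P t *v x = cdot v x *s v"
      and "\<And>i j. adjugate (H (of_real t)) $ i $ j = trace (adjugate (H (of_real t))) * P t $ i $ j"
      by (rule flat_band_projection[OF herm simple nev P[of t]]) (rule that)
    then show ?thesis by (simp add: cis Qk A D_def flat_band_denominator_def)
  qed
  have dA: "degree (A i j) \<le> 2 * N" for i j
    using degree_adjugate_le[of "bloch_poly a m" "2 * m" i j] degree_bloch_poly_le[of a m]
    by (simp add: A_def N_def mult_ac)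
  have dQ: "degree Q \<le> 2 * N" unfolding Q_def by (intro degree_sum_le) (auto simp: dA)
  \<comment> \<open>On the circle Q = z^N D, and D is real there because the adjugate of a Hermitian
    matrix is Hermitian.\<close>
  have self: "poly Q \<zeta> = \<zeta> ^ (2 * N) * cnj (poly Q \<zeta>)" if n: "norm \<zeta> = 1" for \<zeta>
  proof -
    obtain t where t: "\<zeta> = cis t" using cis_Arg_unit[OF n] by metis
    have "hermitian (adjugate (H (of_real t)))"
      using herm[of t] by (simp add: hermitian_def flip: adjugate_conj_transpose)
    then have "cnj (adjugate (H (of_real t)) $ i $ i) = adjugate (H (of_real t)) $ i $ i" for i
      by (rule hermitian_nth)
    then have D: "cnj (D (of_real t)) = D (of_real t)" by (simp add: D_def flat_band_denominator_def trace_def)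
    have "exp (\<i> * of_nat N * of_real t) = \<zeta> ^ N"
      unfolding t Complex.DeMoivre by (simp add: cis_conv_exp mult_ac)
    then have Qz: "poly Q \<zeta> = \<zeta> ^ N * D (of_real t)" using Qk[of "of_real t"] by (simp add: t cis)
    have e: "\<zeta> ^ N * cnj (\<zeta> ^ N) = 1" using that
      by (metis complex_norm_square norm_power of_real_1 power_one)
    have "\<zeta> ^ (2 * N) * cnj (poly Q \<zeta>) = (\<zeta> ^ N * cnj (\<zeta> ^ N)) * (\<zeta> ^ N * D (of_real t))"
      unfolding Qz mult_2 power_add complex_cnj_mult D by (simp only: mult_ac)
    also have "\<dots> = \<zeta> ^ N * D (of_real t)" by (simp only: e mult_1)
    finally have "\<zeta> ^ (2 * N) * cnj (poly Q \<zeta>) = \<zeta> ^ N * D (of_real t)" .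
    then show ?thesis by (simp add: Qz)
  qed
  have Qn: "Q \<noteq> 0" using Q0[of 0] by auto
  have "\<exists>c. c \<noteq> 0 \<and> Q = smult c ((\<Prod>l=1..N. [:- z l, 1:]) * (\<Prod>l=1..N. [:1, - cnj (z l):]))"
  proof (rule self_reciprocal_factorization[OF Qn dQ self])
    show "norm (z l) < 1" if "l \<in> {1..N}" for l using y[OF that] by (simp add: z_def norm_mult)
    show "card {l\<in>{1..N}. z l = w} \<le> order w Q" for w
      unfolding z_def by (rule card_upper_zeros_le_order[OF L Qn Dk[unfolded D_def]])
  qed
  then obtain c where c: "c \<noteq> 0" "Q = smult c ((\<Prod>l=1..N. [:- z l, 1:]) * (\<Prod>l=1..N. [:1, - cnj (z l):]))"
    by blast
  have hP: "hermitian (P k)" "P k ** P k = P k" for k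
    using P[of k] by (auto simp: orthogonal_projection_onto_def)
  obtain v where v: "cdot v v = 1" "\<And>x. P k *v x = cdot v x *s v"
    and "\<And>i j. adjugate (H (of_real k)) $ i $ j = trace (adjugate (H (of_real k))) * P k $ i $ j"
    by (rule flat_band_projection[OF herm simple nev P[of k]]) (rule that)
  \<comment> \<open>Differentiability of \<open>P\<close> comes from \<open>PQ\<close>: its entries
    are rational in z with a denominator that has no zero on the circle.\<close>
  define P' where "P' = (\<chi> i j. vector_derivative (\<lambda>t. poly (A i j) (cis t) / poly Q (cis t)) (at k))"
  have dP: "(P has_vector_derivative P') (at k)"
    unfolding has_vector_derivative_matrix_iff
  proof (intro allI)
    fix i j
    have eq: "(\<lambda>t. P t $ i $ j) = (\<lambda>t. poly (A i j) (cis t) / poly Q (cis t))"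
      using PQ Q0 by (simp add: fun_eq_iff nonzero_eq_divide_eq)
    have g: "((\<lambda>z. poly (A i j) z / poly Q z) has_field_derivative
       (poly (pderiv (A i j)) (cis k) * poly Q (cis k) - poly (A i j) (cis k) * poly (pderiv Q) (cis k)) / (poly Q (cis k))\<^sup>2) (at (cis k))"
      using Q0[of k] by (auto intro!: derivative_eq_intros simp: power2_eq_square)
    have "(cis has_vector_derivative \<i> * cis k) (at k)"
      by (auto intro!: derivative_eq_intros simp: scaleR_conv_of_real has_vector_derivative_def has_derivative_cis)
    note d = field_vector_diff_chain_at[OF this g, unfolded o_def]
    show "((\<lambda>t. P t $ i $ j) has_vector_derivative P' $ i $ j) (at k)"
      unfolding eq P'_def vec_lambda_beta vector_derivative_at[OF d] by (rule d)
  qed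
  show ?thesis
  proof (rule quantum_metric_le[of P, OF hP v dP])
    show "0 \<le> (\<Sum>l=1..N. poisson_kernel (y l) (k - x l))"
      by (intro sum_nonneg poisson_kernel_nonneg less_imp_le y)
    fix w :: "complex^'n" and s :: real
    define F where "F = (\<lambda>t. Re (cdot w (P t *v w)) - 1)"
    assume w: "(norm w)\<^sup>2 = 2" and w1: "Re (cdot w (P k *v w)) = 1"
      and "((\<lambda>k. Re (cdot w (P k *v w)) - 1) has_real_derivative s) (at k)"
    then have F': "(F has_real_derivative s) (at k)" by (simp add: F_def)
    \<comment> \<open>The subtracted \<open>Q\<close> is the -1 in \<open>F\<close>, which centres
      the range [0, 2] of the form at 0.\<close>
    define T where "T = (\<Sum>i\<in>UNIV. \<Sum>j\<in>UNIV. smult (cnj (w $ i) * w $ j) (A i j)) - Q"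
    show "\<bar>s\<bar> \<le> (\<Sum>l=1..N. poisson_kernel (y l) (k - x l))"
    proof (rule bernstein_rational[OF y c(1) c(2)[unfolded z_def] _ _ _ F'])
      fix t
      have "cnj (cdot w (P t *v w)) = cdot w (P t *v w)"
        by (simp add: cnj_cdot cdot_hermitian[OF hP(1)])
      then have "of_real (Re (cdot w (P t *v w))) = cdot w (P t *v w)"
        by (metis Reals_cnj_iff of_real_Re)
      moreover have "cdot w (P t *v w) * poly Q (cis t) = (\<Sum>i\<in>UNIV. \<Sum>j\<in>UNIV. cnj (w $ i) * w $ j * (P t $ i $ j * poly Q (cis t)))"
        by (simp add: cdot_def matrix_vector_mult_def sum_distrib_left sum_distrib_right mult_ac)
      ultimately show "of_real (F t) * poly Q (cis t) = poly T (cis t)"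
        by (simp add: F_def T_def PQ poly_sum left_diff_distrib)
      show "\<bar>F t\<bar> \<le> 1"
        using hermitian_idempotent_form_bounds[OF hP, of w t] w by (simp add: F_def abs_le_iff)
    next
      show "F k = 0" by (simp add: F_def w1)
    qed auto
  qed
qed

theorem theorem3:
  fixes a :: "int \<Rightarrow> complex^'n^'n" and m N :: nat
    and H :: "complex \<Rightarrow> complex^'n^'n"
    and P\<^sub>f :: "real \<Rightarrow> complex^'n^'n"
    and x y :: "nat \<Rightarrow> real" and y_min :: real
  defines "H \<equiv> bloch_hamiltonian a m"
    and "N \<equiv> (CARD('n) - 1) * m"
    and "y_min \<equiv> Min (y ` {1..N})"
  assumes "\<And>k::real. hermitian (H (of_real k))"
    and "isolated_flat_band_at_zero H"
    and "\<And>k::real. orthogonal_projection_onto (P\<^sub>f k) (eigenspace (H (of_real k)) 0)"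
    and "lists_upper_zeros (flat_band_denominator H) N x y"
  shows "quantum_metric_length P\<^sub>f
           \<le> 1/4 * (\<Sum>i=1..N. \<Sum>j=1..N. poisson_kernel (y i + y j) (x i - x j))
       \<and> 1/4 * (\<Sum>i=1..N. \<Sum>j=1..N. poisson_kernel (y i + y j) (x i - x j))
           \<le> (real N)\<^sup>2 / 4 * coth y_min"
proof
  have y: "y l > 0" if "l \<in> {1..N}" for l using assms(7) that by (simp add: lists_upper_zeros_def)
  let ?R = "1/4 * (\<Sum>i=1..N. \<Sum>j=1..N. poisson_kernel (y i + y j) (x i - x j))"
  define \<Theta> where "\<Theta> = (\<lambda>k. \<Sum>l=1..N. poisson_kernel (y l) (k - x l))"
  have le: "quantum_metric P\<^sub>f k \<le> 1/4 * (\<Theta> k)\<^sup>2" for k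
    using quantum_metric_bound[of a m P\<^sub>f x y k] assms(4-7) by (simp add: \<Theta>_def H_def N_def)
  \<comment> \<open>The constant is 1/4 from the pointwise bound times 1 / (2 pi) from the average
    over k.\<close>
  have "((\<lambda>k. 1 / (8 * pi) * (\<Sum>i=1..N. \<Sum>j=1..N. poisson_kernel (y i) (k - x i) * poisson_kernel (y j) (k - x j)))
    has_integral 1 / (8 * pi) * (\<Sum>i=1..N. \<Sum>j=1..N. 2 * pi * poisson_kernel (y i + y j) (x i - x j))) {0..2*pi}"
    by (intro has_integral_mult_right has_integral_sum poisson_kernel_convolution y) auto
  also have "1 / (8 * pi) * (\<Sum>i=1..N. \<Sum>j=1..N. 2 * pi * poisson_kernel (y i + y j) (x i - x j)) = ?R"
    by (simp flip: sum_distrib_left)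
  also have "(\<lambda>k. 1 / (8 * pi) * (\<Sum>i=1..N. \<Sum>j=1..N. poisson_kernel (y i) (k - x i) * poisson_kernel (y j) (k - x j)))
    = (\<lambda>k. (1/4 * (\<Theta> k)\<^sup>2) / (2 * pi))"
    by (simp add: \<Theta>_def power2_eq_square sum_product)
  finally have I: "((\<lambda>k. (1/4 * (\<Theta> k)\<^sup>2) / (2 * pi)) has_integral ?R) {0..2*pi}" .
  \<comment> \<open>Integrability is settled by cases: \<open>integral\<close> is 0 by default on a
    non-integrable function, and the right side is nonnegative.\<close>
  show "quantum_metric_length P\<^sub>f \<le> ?R"
  proof (cases "(\<lambda>k. quantum_metric P\<^sub>f k / (2 * pi)) integrable_on {0..2*pi}")
    case True
    moreover have "quantum_metric P\<^sub>f k / (2 * pi) \<le> (1/4 * (\<Theta> k)\<^sup>2) / (2 * pi)" for k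
      by (rule divide_right_mono[OF le]) simp
    ultimately have "quantum_metric_length P\<^sub>f \<le> integral {0..2*pi} (\<lambda>k. (1/4 * (\<Theta> k)\<^sup>2) / (2 * pi))"
      unfolding quantum_metric_length_def using I by (intro integral_le) (blast intro: has_integral_integrable)+
    then show ?thesis using integral_unique[OF I] by simp
  next
    case False
    then have "quantum_metric_length P\<^sub>f = 0"
      by (simp add: quantum_metric_length_def not_integrable_integral)
    also have "0 \<le> ?R"
      by (intro mult_nonneg_nonneg sum_nonneg poisson_kernel_nonneg) (auto intro!: add_pos_pos less_imp_le y)
    finally show ?thesis .
  qed
  \<comment> \<open>For N = 0 \<open>y_min\<close> is a minimum of the empty set, but then no pair
    i, j exists and both sides of the final bound are 0.\<close>
  have "poisson_kernel (y i + y j) (x i - x j) \<le> coth y_min" if ij: "i \<in> {1..N}" "j \<in> {1..N}" for i j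
  proof (rule poisson_kernel_le_coth)
    have "y_min \<in> y ` {1..N}" unfolding y_min_def using ij by (intro Min_in) auto
    then show "0 < y_min" using y by auto
    have "y_min \<le> y i" "y_min \<le> y j" unfolding y_min_def using ij by (auto intro!: Min_le)
    then show "2 * y_min \<le> y i + y j" by simp
  qed
  then have "(\<Sum>i=1..N. \<Sum>j=1..N. poisson_kernel (y i + y j) (x i - x j)) \<le> (\<Sum>i=1..N. \<Sum>j=1..N. coth y_min)"
    by (intro sum_mono)
  then show "?R \<le> (real N)\<^sup>2 / 4 * coth y_min" by (simp add: power2_eq_square)
qed

end
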